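(* There exist constants $K_n>0$ (for integers $n\ge3$) with $\lim_{n\to\infty}K_n=1/3$ such that for every $n\ge 3$ $$r_{n+1}(\beta)=1-K_n(1-\beta)+\mathcal O\big((1-\beta)^2\big).$$
   Context: $\beta$ denotes a real number with $0\le\beta\le 1$. For an integer $m\ge2$, $S(m,\beta)$ is the set of complex polynomials of degree $m$ with all roots in the closed unit disk and at least one root at $\beta$. For a polynomial $P$, $|P|_\beta$ is the distance between $\beta$ and the closest root of the derivative $P'$. Define $r_m(\beta)=\sup\{|P|_\beta: P\in S(m,\beta)\}$. The notation $\mathcal O((1-\beta)^s)$ denotes a quantity bounded in modulus by $C(1-\beta)^s$ for all $\beta\in(\beta_0,1)$, where $C$ and $\beta_0<1$ depend only on $n$. *)

theory Defs
  imports "HOL-Analysis.Analysis" "HOL-Computational_Algebra.Computational_Algebra"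
begin

definition S_polys :: "nat \<Rightarrow> real \<Rightarrow> complex poly set" where
  "S_polys m \<beta> =
     {P. degree P = m \<and> (\<forall>z. poly P z = 0 \<longrightarrow> cmod z \<le> 1) \<and> poly P (complex_of_real \<beta>) = 0}"

(* For degree P \<ge> 2 the derivative has a nonempty finite set of roots, so the infimum in
   infdist is the minimum over these roots, and the empty-set default of infdist plays no role. *)
definition crit_dist :: "real \<Rightarrow> complex poly \<Rightarrow> real" where
  "crit_dist \<beta> P = infdist (complex_of_real \<beta>) {z. poly (pderiv P) z = 0}"

(* For m \<ge> 2 and 0 \<le> \<beta> \<le> 1 this is a genuine supremum: the set is nonempty, since it contains
   the value at (z - \<beta>)^m, and by Gauss-Lucas it is bounded above by 2. *)
definition r_sup :: "nat \<Rightarrow> real \<Rightarrow> real" where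
  "r_sup m \<beta> = Sup (crit_dist \<beta> ` S_polys m \<beta>)"

end

theory Submission
  imports Defs "HOL-Complex_Analysis.Weierstrass_Factorization"
begin

text \<open>
  Write \<open>\<epsilon> = 1 - \<beta>\<close> and \<open>N = n + 1\<close>. At \<open>\<beta> = 1\<close> the polynomial with the largest critical
  distance is \<open>z ^ N - 1\<close>, whose critical points all vanish; the expansion comes from perturbing it.
  The real parts of the critical points \<open>\<zeta>\<close> of a competitor \<open>P\<close> are of order \<open>\<epsilon>\<close>, but their
  imaginary parts may be of order \<open>sqrt \<epsilon>\<close>, because moving \<open>\<zeta>\<close> off the real axis increases
  \<open>|\<beta> - \<zeta>|\<close>. So the imaginary parts enter at first order, and they do so only through the one
  parameter \<open>t = (\<Sum> (Im \<zeta>)\<^sup>2) / (2\<epsilon>)\<close>. For a fixed \<open>t\<close>, the condition that the roots of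
  \<open>P\<close> near an \<open>N\<close>-th root of unity \<open>w \<noteq> 1\<close> and near \<open>cnj w\<close> stay in the unit disk bounds the
  critical distance by
  \<open>1 - (1 + root_constraint n t (Re w)) \<epsilon>\<close> up to \<open>O(\<epsilon>\<^sup>2)\<close>. Taking the worst \<open>w\<close> and then the best
  \<open>t\<close> gives the constant \<open>K\<close> of the theorem, \<open>sendov_slope n\<close>. It is the value of a linear program
  in two variables, which duality bounds from below: the weights \<open>1 - Re w\<close> give positivity, and a
  single \<open>w\<close> near \<open>exp (2 \<pi> \<i> / 3)\<close> gives the limit \<open>1/3\<close>.

  Upper bound (\<open>crit_dist_upper_bound\<close>). The identity \<open>P''(\<beta>) / P'(\<beta>) = \<Sum> 1 / (\<beta> - \<zeta>)\<close> forces
  the critical points into the region above (\<open>critical_points_near_zero\<close>). The coefficients of \<open>P\<close>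
  are read off from the elementary symmetric functions of the \<open>\<zeta>\<close>, and instead of locating the
  roots of \<open>P\<close> one uses that \<open>Re (w P'(w) cnj (P w)) \<ge> 0\<close> on the unit circle, which becomes
  \<open>Re (P w) \<ge> - O(\<epsilon>\<^sup>2)\<close> at the roots of unity (\<open>Re_poly_at_unity_root_ge\<close>). Adding this inequality
  at \<open>w\<close> and at \<open>cnj w\<close> removes the imaginary parts of the coefficients; these are the source of the
  terms of order \<open>\<epsilon> powr (3/2)\<close>, so the error is really \<open>O(\<epsilon>\<^sup>2)\<close>.

  Lower bound (\<open>crit_dist_lower_bound\<close>). In the coordinate \<open>v = 1 + (z - \<beta>) / r\<close> the polynomial with
  derivative \<open>N v ^ (n - 2) (v\<^sup>2 - g v + g)\<close> that vanishes at \<open>v = 1\<close> has all its critical points at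
  distance exactly \<open>1\<close> from \<open>1\<close>, so its critical distance in \<open>z\<close> is exactly \<open>r\<close>. With \<open>g = t \<epsilon>\<close> for
  the optimal \<open>t\<close> and \<open>r = 1 - K \<epsilon> - C \<epsilon>\<^sup>2\<close> for a large \<open>C\<close>, all its roots lie in the unit disk.
\<close>

section \<open>The first-order coefficient as the value of a linear program\<close>

definition nontrivial_unity_roots :: "nat \<Rightarrow> complex set" where
  "nontrivial_unity_roots N = {w. w ^ N = 1 \<and> w \<noteq> 1}"

text \<open>
  Here \<open>c\<close> is the real part of a root of unity \<open>w\<close> and \<open>t\<close> is half the sum of the squared imaginary
  parts of the critical points, divided by \<open>1 - \<beta>\<close>. To first order in \<open>1 - \<beta>\<close>, the roots of
  the polynomial near \<open>w\<close> and \<open>cnj w\<close> lie in the unit disk only if the critical distance is at most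
  \<open>1 - (1 + root_constraint n t c) (1 - \<beta>)\<close>.
\<close>
definition root_constraint :: "nat \<Rightarrow> real \<Rightarrow> real \<Rightarrow> real" where
  "root_constraint n t c = t * (2 * (1 + c) / (real n - 1) - 1 / real n) - 1 / (1 - c)"

definition max_constraint :: "nat \<Rightarrow> real \<Rightarrow> real" where
  "max_constraint n t =
     Max ((\<lambda>w. root_constraint n t (Re w)) ` nontrivial_unity_roots (n + 1))"

definition sendov_slope :: "nat \<Rightarrow> real" where
  "sendov_slope n = 1 + Inf (max_constraint n ` {0..})"

lemma unity_root_norm: "w ^ N = 1 \<Longrightarrow> N > 0 \<Longrightarrow> cmod w = 1" for w :: complex
  by (metis norm_one norm_power norm_ge_zero power_eq_1_iff less_numeral_extra(3))

lemma nontrivial_unity_rootsD: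
  assumes "w \<in> nontrivial_unity_roots N" "N > 0"
  shows "w ^ N = 1" "cmod w = 1" "Re w < 1" "-1 \<le> Re w"
proof -
  show 1: "w ^ N = 1" and 2: "cmod w = 1"
    using assms unity_root_norm by (auto simp: nontrivial_unity_roots_def)
  have "Re w \<noteq> 1"
  proof
    assume a: "Re w = 1"
    with 2 have "Im w = 0" by (auto simp: cmod_def)
    with a have "w = 1" by (simp add: complex_eq_iff)
    with assms show False by (simp add: nontrivial_unity_roots_def)
  qed
  moreover have "\<bar>Re w\<bar> \<le> 1" using 2 abs_Re_le_cmod[of w] by simp
  ultimately show "Re w < 1" "-1 \<le> Re w" by auto
qed

lemma cis_root_in:
  assumes "0 < k" "k < N"
  shows "cis (2 * pi * real k / real N) \<in> nontrivial_unity_roots N"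
proof -
  have "real N * (2 * pi * real k / real N) = 2 * pi * real k" using assms by simp
  hence "cis (2 * pi * real k / real N) ^ N = cis (2 * pi * real k)"
    by (simp only: Complex.DeMoivre)
  also have "\<dots> = 1" by (metis Complex.DeMoivre cis_2pi mult.commute power_one)
  finally have 1: "cis (2 * pi * real k / real N) ^ N = 1" .
  have "cis (2 * pi * real k / real N) \<noteq> 1"
  proof
    assume "cis (2 * pi * real k / real N) = 1"
    hence "cos (2 * pi * real k / real N) = 1" by (simp add: complex_eq_iff)
    then obtain m :: int where "2 * pi * real k / real N = of_int m * 2 * pi"
      using cos_one_2pi_int by auto
    hence "2 * pi * (real k / real N) = 2 * pi * of_int m" by (simp add: mult_ac)
    hence "real k / real N = of_int m" by (subst (asm) mult_cancel_left) simp
    moreover have "0 < real k / real N" "real k / real N < 1" using assms by auto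
    ultimately show False by simp
  qed
  with 1 show ?thesis by (simp add: nontrivial_unity_roots_def)
qed

lemma finite_nontrivial_unity_roots: "N > 0 \<Longrightarrow> finite (nontrivial_unity_roots N)"
  by (rule finite_subset[OF _ finite_roots_unity[of N]]) (auto simp: nontrivial_unity_roots_def)

lemma nontrivial_unity_roots_nonempty: "N \<ge> 2 \<Longrightarrow> nontrivial_unity_roots N \<noteq> {}"
  using cis_root_in[of 1 N] by auto

lemma nontrivial_unity_roots_gap:
  assumes "n \<ge> 1"
  obtains m where "m > 0" "\<And>w. w \<in> nontrivial_unity_roots (n + 1) \<Longrightarrow> m \<le> 1 - Re w"
proof -
  define m where "m = Min ((\<lambda>w. 1 - Re w) ` nontrivial_unity_roots (n + 1))"
  have f: "finite (nontrivial_unity_roots (n + 1))" "nontrivial_unity_roots (n + 1) \<noteq> {}"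
    using finite_nontrivial_unity_roots[of "n + 1"] nontrivial_unity_roots_nonempty[of "n + 1"] assms by auto
  have "m > 0" unfolding m_def using f nontrivial_unity_rootsD(3)[of _ "n + 1"] by (subst Min_gr_iff) auto
  moreover have "m \<le> 1 - Re w" if "w \<in> nontrivial_unity_roots (n + 1)" for w
    unfolding m_def using f that by auto
  ultimately show ?thesis using that by blast
qed

lemma root_constraint_le_max:
  assumes "w \<in> nontrivial_unity_roots (n + 1)"
  shows "root_constraint n t (Re w) \<le> max_constraint n t"
  unfolding max_constraint_def
  by (rule Max_ge) (use assms finite_nontrivial_unity_roots[of "n+1"] in auto)

lemma max_constraint_le_iff:
  assumes "n \<ge> 1"
  shows "max_constraint n t \<le> x \<longleftrightarrow>
    (\<forall>w\<in>nontrivial_unity_roots (n + 1). root_constraint n t (Re w) \<le> x)"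
  unfolding max_constraint_def
  using assms finite_nontrivial_unity_roots[of "n+1"] nontrivial_unity_roots_nonempty[of "n+1"]
  by (subst Max_le_iff) auto

lemma sum_unity_roots_squares:
  assumes "N \<ge> 3"
  shows "(\<Sum>w | w ^ N = (1::complex). w\<^sup>2) = 0"
proof -
  define z where "z = cis (2 * pi * real 1 / real N)"
  have zN: "z ^ N = 1"
    using cis_root_in[of 1 N] assms by (simp add: z_def nontrivial_unity_roots_def)
  have "z\<^sup>2 = cis (2 * pi * real 2 / real N)"
    unfolding z_def Complex.DeMoivre by (rule arg_cong[of _ _ cis]) simp
  hence z2: "z\<^sup>2 \<noteq> 1"
    using cis_root_in[of 2 N] assms by (simp add: nontrivial_unity_roots_def)
  have z0: "z \<noteq> 0" by (simp add: z_def)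
  have "bij_betw (\<lambda>w. z * w) {w. w ^ N = 1} {w. w ^ N = 1}"
    by (rule bij_betwI[where g = "\<lambda>w. w / z"])
       (auto simp: power_mult_distrib power_divide zN z0)
  hence "(\<Sum>w | w ^ N = 1. w\<^sup>2) = (\<Sum>w | w ^ N = 1. (z * w)\<^sup>2)"
    by (rule sum.reindex_bij_betw[symmetric])
  also have "\<dots> = z\<^sup>2 * (\<Sum>w | w ^ N = 1. w\<^sup>2)"
    by (simp add: power_mult_distrib sum_distrib_left)
  finally have "(z\<^sup>2 - 1) * (\<Sum>w | w ^ N = 1. w\<^sup>2) = 0" by (simp add: algebra_simps)
  with z2 show ?thesis by simp
qed

text \<open>
  Weak duality. The weighted average of the constraints with weights \<open>(1 - Re w) / (n + 1)\<close> can be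
  evaluated in closed form, because the power sums of the roots of unity of exponents 1 and 2 vanish,
  and it is a lower bound for their maximum. The slope in \<open>t\<close> of this average is positive, which
  makes the minimum over \<open>t\<close> exist, and its value at \<open>t = 0\<close> exceeds \<open>-1\<close>, which makes the constant
  \<open>sendov_slope n\<close> positive.
\<close>
lemma max_constraint_ge:
  assumes n: "n \<ge> 2"
  shows "max_constraint n t \<ge> t * (1 / (real n - 1) - 1 / real n) - real n / (real n + 1)"
proof -
  let ?N = "n + 1"
  let ?R = "{w::complex. w ^ ?N = 1}"
  let ?R' = "nontrivial_unity_roots ?N"
  let ?a = "2 / (real n - 1)" and ?b = "1 / real n"
  have fin: "finite ?R" and fin': "finite ?R'"
    using finite_roots_unity[of ?N] finite_nontrivial_unity_roots[of ?N] by auto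
  have R: "?R = insert 1 ?R'" "1 \<notin> ?R'" by (auto simp: nontrivial_unity_roots_def)
  have card: "card ?R = n + 1" by (rule card_complex_roots_unity) auto
  have card': "card ?R' = n" using card R fin' by simp
  have s1: "(\<Sum>w\<in>?R. Re w) = 0"
  proof -
    have "(\<Sum>w\<in>?R. w) = 0" using sum_roots_unity[of ?N] n by simp
    hence "Re (\<Sum>w\<in>?R. w) = 0" by simp
    thus ?thesis by simp
  qed
  have s2: "(\<Sum>w\<in>?R. (Re w)\<^sup>2) = (real n + 1) / 2"
  proof -
    have "(\<Sum>w\<in>?R. Re (w\<^sup>2)) = 0"
      using sum_unity_roots_squares[of ?N] n by (simp flip: Re_sum)
    moreover have "Re (w\<^sup>2) = 2 * (Re w)\<^sup>2 - 1" if "w \<in> ?R" for w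
    proof -
      have "cmod w = 1" using that unity_root_norm[of w ?N] by simp
      hence "(Re w)\<^sup>2 + (Im w)\<^sup>2 = 1" using cmod_power2[of w] by simp
      thus ?thesis by (simp add: power2_eq_square)
    qed
    hence "(\<Sum>w\<in>?R. Re (w\<^sup>2)) = (\<Sum>w\<in>?R. 2 * (Re w)\<^sup>2 - 1)" by (intro sum.cong) auto
    also have "\<dots> = 2 * (\<Sum>w\<in>?R. (Re w)\<^sup>2) - (real n + 1)"
      using card by (simp add: sum_subtractf sum_distrib_left)
    ultimately show ?thesis by simp
  qed
  have w1: "(\<Sum>w\<in>?R'. 1 - Re w) = real n + 1"
  proof -
    have "(\<Sum>w\<in>?R. 1 - Re w) = real n + 1" using s1 card by (simp add: sum_subtractf)
    thus ?thesis using R fin' by simp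
  qed
  have w2: "(\<Sum>w\<in>?R'. 1 - (Re w)\<^sup>2) = (real n + 1) / 2"
  proof -
    have "(\<Sum>w\<in>?R. 1 - (Re w)\<^sup>2) = (real n + 1) / 2" using s2 card by (simp add: sum_subtractf)
    thus ?thesis using R fin' by simp
  qed
  have "(\<Sum>w\<in>?R'. (1 - Re w) * root_constraint n t (Re w)) \<le>
        (\<Sum>w\<in>?R'. (1 - Re w) * max_constraint n t)"
    using nontrivial_unity_rootsD[of _ ?N]
    by (intro sum_mono mult_left_mono root_constraint_le_max) (auto simp: less_imp_le)
  also have "\<dots> = (real n + 1) * max_constraint n t"
    using w1 by (simp flip: sum_distrib_right)
  finally have *: "(\<Sum>w\<in>?R'. (1 - Re w) * root_constraint n t (Re w)) \<le>
                   (real n + 1) * max_constraint n t" .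
  have "(1 - Re w) * root_constraint n t (Re w) =
        t * ?a * (1 - (Re w)\<^sup>2) - t * ?b * (1 - Re w) - 1" if "w \<in> ?R'" for w
  proof -
    have "1 - Re w \<noteq> 0" using nontrivial_unity_rootsD[OF that] by simp
    hence "(1 - Re w) * (1 / (1 - Re w)) = 1" by simp
    moreover have "(1 - Re w) * (t * (2 * (1 + Re w) / (real n - 1) - 1 / real n)) =
        t * ?a * (1 - (Re w)\<^sup>2) - t * ?b * (1 - Re w)"
      by (simp add: divide_inverse power2_eq_square algebra_simps)
    ultimately show ?thesis
      by (simp only: root_constraint_def right_diff_distrib)
  qed
  hence "(\<Sum>w\<in>?R'. (1 - Re w) * root_constraint n t (Re w)) =
         (\<Sum>w\<in>?R'. t * ?a * (1 - (Re w)\<^sup>2) - t * ?b * (1 - Re w) - 1)"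
    by (intro sum.cong) auto
  also have "\<dots> = t * ?a * ((real n + 1) / 2) - t * ?b * (real n + 1) - real n"
    using w1 w2
    by (simp only: sum_subtractf sum_distrib_left[symmetric]
          sum_constant card' mult_1_right)
  also have "\<dots> = (real n + 1) * (t * (1 / (real n - 1) - 1 / real n) - real n / (real n + 1))"
  proof -
    have "(real n + 1) * (real n / (real n + 1)) = real n" by simp
    moreover have "t * ?a * ((real n + 1) / 2) = (real n + 1) * (t * (1 / (real n - 1)))"
      using n by (simp add: field_simps)
    moreover have "t * ?b * (real n + 1) = (real n + 1) * (t * (1 / real n))" by (simp only: mult_ac)
    ultimately show ?thesis unfolding right_diff_distrib by linarith
  qed
  finally show ?thesis using * by (simp add: mult_le_cancel_left)
qed

lemma continuous_on_max_constraint: "continuous_on S (max_constraint n)"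
proof -
  have gen: "continuous_on S (\<lambda>t. Max ((\<lambda>w. root_constraint n t (Re w)) ` F))"
    if "finite F" "F \<noteq> {}" for F
    using that
  proof (induction F rule: finite_ne_induct)
    case (singleton w)
    thus ?case by (simp add: root_constraint_def, intro continuous_intros)
  next
    case (insert w F)
    have "continuous_on S (\<lambda>t. root_constraint n t (Re w))"
      unfolding root_constraint_def by (intro continuous_intros)
    hence "continuous_on S (\<lambda>t. max (root_constraint n t (Re w))
             (Max ((\<lambda>w. root_constraint n t (Re w)) ` F)))"
      using insert.IH by (rule continuous_on_max)
    with insert.hyps show ?case by simp
  qed
  show ?thesis
  proof (cases "n = 0")
    case True
    have "nontrivial_unity_roots (n + 1) = {}" using True by (auto simp: nontrivial_unity_roots_def)
    thus ?thesis by (simp add: max_constraint_def[abs_def])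
  next
    case False
    show ?thesis unfolding max_constraint_def[abs_def]
      by (rule gen) (use False finite_nontrivial_unity_roots nontrivial_unity_roots_nonempty in auto)
  qed
qed

lemma max_constraint_zero:
  assumes "n \<ge> 1"
  shows "max_constraint n 0 < 0"
proof -
  have "max_constraint n 0 \<le> -1/2"
    unfolding max_constraint_le_iff[OF assms]
  proof
    fix w assume "w \<in> nontrivial_unity_roots (n + 1)"
    hence "Re w < 1" "-1 \<le> Re w" using nontrivial_unity_rootsD by auto
    thus "root_constraint n 0 (Re w) \<le> -1/2"
      by (simp add: root_constraint_def field_simps)
  qed
  thus ?thesis by simp
qed

lemma max_constraint_bdd_below:
  assumes "n \<ge> 2" shows "bdd_below (max_constraint n ` {0..})"
proof (rule bdd_belowI2)
  fix t :: real assume t: "t \<in> {0..}"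
  have "1 / real n \<le> 1 / (real n - 1)" using assms by (simp add: frac_le)
  hence "0 \<le> t * (1 / (real n - 1) - 1 / real n)" using t by (intro mult_nonneg_nonneg) auto
  with max_constraint_ge[OF assms, of t]
  show "- (real n / (real n + 1)) \<le> max_constraint n t" by linarith
qed

lemma sendov_slope_le:
  assumes "n \<ge> 2" "t \<ge> 0"
  shows "sendov_slope n \<le> 1 + max_constraint n t"
  unfolding sendov_slope_def using assms
  by (auto intro!: cINF_lower max_constraint_bdd_below)

lemma sendov_slope_attained:
  assumes n: "n \<ge> 2"
  obtains t where "t \<ge> 0" "sendov_slope n = 1 + max_constraint n t"
proof -
  let ?g = "1 / (real n - 1) - 1 / real n"
  have g: "?g > 0" using n by (simp add: frac_less2)
  obtain T where T: "T > 0" "T * ?g \<ge> 1"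
    using g by (intro that[of "1 / ?g"]) auto
  obtain t where t: "t \<in> {0..T}" "\<And>s. s \<in> {0..T} \<Longrightarrow> max_constraint n t \<le> max_constraint n s"
    using continuous_attains_inf[of "{0..T}" "max_constraint n"]
      continuous_on_max_constraint[of "{0..T}" n] T by auto
  have min: "max_constraint n t \<le> max_constraint n s" if "s \<ge> 0" for s
  proof (cases "s \<le> T")
    case True thus ?thesis using t that by auto
  next
    case False
    have "1 \<le> T * ?g" by (rule T)
    also have "\<dots> \<le> s * ?g" using False g by (intro mult_right_mono) auto
    finally have "max_constraint n s \<ge> 0"
      using max_constraint_ge[OF n, of s] n
      by (smt (verit) divide_le_eq_1 of_nat_0_le_iff)
    moreover have "max_constraint n t \<le> max_constraint n 0" using t T by auto
    ultimately show ?thesis using max_constraint_zero[of n] n by linarith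
  qed
  have "Inf (max_constraint n ` {0..}) = max_constraint n t"
    by (rule cInf_eq_minimum) (use t min in auto)
  thus ?thesis using t by (intro that[of t]) (auto simp: sendov_slope_def)
qed

lemma sendov_slope_pos:
  assumes "n \<ge> 2" shows "sendov_slope n > 0"
proof -
  obtain t where t: "t \<ge> 0" "sendov_slope n = 1 + max_constraint n t"
    using sendov_slope_attained[OF assms] .
  have "1 / real n \<le> 1 / (real n - 1)" using assms by (simp add: frac_le)
  hence "0 \<le> t * (1 / (real n - 1) - 1 / real n)" using t by (intro mult_nonneg_nonneg) auto
  moreover have "real n / (real n + 1) < 1" by simp
  ultimately show ?thesis using max_constraint_ge[OF assms, of t] t by linarith
qed

lemma sendov_slope_less_1: "n \<ge> 2 \<Longrightarrow> sendov_slope n < 1"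
  using sendov_slope_le[of n 0] max_constraint_zero[of n] by simp

text \<open>
  The value \<open>t = 2 (n - 1) / 9\<close> makes the constraint, a concave function of \<open>c\<close>, maximal at
  \<open>c = -1/2\<close>. The claim is then the tangent line inequality for
  \<open>1 / (1 - c)\<close> at \<open>-1/2\<close>, which is the square \<open>(2 c + 1)\<^sup>2 \<ge> 0\<close>.
\<close>
lemma sendov_slope_upper:
  assumes n: "n \<ge> 2"
  shows "sendov_slope n \<le> 1/3 + 2 / (9 * real n)"
proof -
  define t where "t = 2 * (real n - 1) / 9"
  have "max_constraint n t \<le> -2/3 + 2 / (9 * real n)"
  proof (subst max_constraint_le_iff, use n in simp, intro ballI)
    fix w assume "w \<in> nontrivial_unity_roots (n + 1)"
    hence c: "Re w < 1" using nontrivial_unity_rootsD by auto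
    define c where "c = Re w"
    have "1 / (1 - c) \<ge> 4 * (1 + c) / 9 + 4 / 9"
    proof -
      have "(4 * (1 + c) / 9 + 4 / 9) * (1 - c) \<le> 1"
        using zero_le_power2[of "2 * c + 1"] by (simp add: power2_eq_square field_simps)
      thus ?thesis using c by (simp add: c_def pos_le_divide_eq)
    qed
    moreover have "t * (2 * (1 + c) / (real n - 1)) = 4 * (1 + c) / 9"
      using n by (simp add: t_def field_simps)
    moreover have "t * (1 / real n) = 2 / 9 - 2 / (9 * real n)"
      using n by (simp add: t_def field_simps)
    ultimately show "root_constraint n t (Re w) \<le> -2/3 + 2 / (9 * real n)"
      unfolding root_constraint_def c_def[symmetric] right_diff_distrib by linarith
  qed
  moreover have "t \<ge> 0" using n by (simp add: t_def)
  ultimately show ?thesis using sendov_slope_le[OF n, of t] by linarith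
qed

text \<open>
  A single constraint suffices if its coefficient of \<open>t\<close> is nonnegative, since then \<open>t = 0\<close> is the
  most favourable value. The coefficient is nonnegative as soon as \<open>c \<ge> -1/2\<close>, so the angle is the
  largest multiple of \<open>2 \<pi> / (n + 1)\<close> that does not exceed \<open>2 \<pi> / 3\<close>.
\<close>
lemma sendov_slope_lower:
  assumes n: "n \<ge> 3"
  shows "sendov_slope n \<ge> 1 - 1 / (1 - cos (2 * pi * real ((n + 1) div 3) / real (n + 1)))"
proof -
  obtain t where t: "t \<ge> 0" "sendov_slope n = 1 + max_constraint n t"
    using sendov_slope_attained[of n] n by auto
  define k where "k = (n + 1) div 3"
  define \<theta> where "\<theta> = 2 * pi * real k / real (n + 1)"
  have k: "0 < k" "k < n + 1" "3 * k \<le> n + 1" using n by (auto simp: k_def)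
  have \<theta>: "0 \<le> \<theta>" "\<theta> \<le> 2 * pi / 3"
  proof -
    have "3 * real k \<le> real (n + 1)" using k(3) by linarith
    hence "real k / real (n + 1) \<le> 1 / 3" by (simp add: field_simps)
    hence "2 * pi * (real k / real (n + 1)) \<le> 2 * pi * (1 / 3)" by (intro mult_left_mono) auto
    thus "\<theta> \<le> 2 * pi / 3" by (simp add: \<theta>_def)
  qed (simp add: \<theta>_def)
  have c: "cos \<theta> \<ge> - 1/2"
  proof -
    have "cos (2 * pi / 3) \<le> cos \<theta>" using \<theta> by (intro cos_monotone_0_pi_le) auto
    thus ?thesis using cos_120 by simp
  qed
  have "1 / real n \<le> 1 / (real n - 1)" using n by (simp add: frac_le)
  also have "\<dots> \<le> 2 * (1 + cos \<theta>) / (real n - 1)" using n c by (intro divide_right_mono) auto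
  finally have "0 \<le> t * (2 * (1 + cos \<theta>) / (real n - 1) - 1 / real n)"
    using t by (intro mult_nonneg_nonneg) auto
  hence "- 1 / (1 - cos \<theta>) \<le> root_constraint n t (Re (cis \<theta>))"
    by (simp add: root_constraint_def)
  also have "\<dots> \<le> max_constraint n t"
    using cis_root_in[OF k(1,2)] by (intro root_constraint_le_max) (simp add: \<theta>_def)
  finally show ?thesis using t by (simp add: \<theta>_def k_def)
qed

lemma sendov_slope_tendsto: "sendov_slope \<longlonglongrightarrow> 1 / 3"
proof (rule tendsto_sandwich)
  show "\<forall>\<^sub>F n in sequentially. 1 - 1 / (1 - cos (2 * pi * real ((n + 1) div 3) / real (n + 1)))
          \<le> sendov_slope n"
    using eventually_ge_at_top[of 3] by eventually_elim (rule sendov_slope_lower)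
  show "\<forall>\<^sub>F n in sequentially. sendov_slope n \<le> 1/3 + 2 / (9 * real n)"
    using eventually_ge_at_top[of 2] by eventually_elim (rule sendov_slope_upper)
  have "(\<lambda>n. 1/3 + 2/9 * (1 / real n)) \<longlonglongrightarrow> 1/3 + 2/9 * 0"
    by (intro tendsto_intros lim_1_over_n)
  thus "(\<lambda>n. 1/3 + 2 / (9 * real n)) \<longlonglongrightarrow> 1/3"
    by simp
  have lim: "(\<lambda>n. real ((n + 1) div 3) / real (n + 1)) \<longlonglongrightarrow> 1 / 3"
  proof (rule tendsto_sandwich)
    show "\<forall>\<^sub>F n in sequentially. 1/3 - 1 / real (n + 1) \<le> real ((n + 1) div 3) / real (n + 1)"
    proof (intro always_eventually allI)
      fix n :: nat
      have "n + 1 \<le> 3 * ((n + 1) div 3) + 3" by linarith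
      hence "real (n + 1) \<le> 3 * real ((n + 1) div 3) + 3" by linarith
      moreover have "m / 3 - 1 \<le> x" if "m \<le> 3 * x + 3" for m x :: real
        using that by linarith
      ultimately have "real (n + 1) / 3 - 1 \<le> real ((n + 1) div 3)" by blast
      thus "1/3 - 1 / real (n + 1) \<le> real ((n + 1) div 3) / real (n + 1)"
        using divide_right_mono[of "real (n + 1) / 3 - 1" "real ((n + 1) div 3)" "real (n + 1)"]
        by (simp add: diff_divide_distrib del: of_nat_add of_nat_Suc Suc_eq_plus1 flip: Suc_eq_plus1)
    qed
    show "\<forall>\<^sub>F n in sequentially. real ((n + 1) div 3) / real (n + 1) \<le> 1/3"
    proof (intro always_eventually allI)
      fix n :: nat
      have "3 * ((n + 1) div 3) \<le> n + 1" by linarith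
      hence "3 * real ((n + 1) div 3) \<le> real (n + 1)" by linarith
      thus "real ((n + 1) div 3) / real (n + 1) \<le> 1/3" by (simp add: field_simps)
    qed
    have "(\<lambda>n. 1/3 - inverse (real (Suc n))) \<longlonglongrightarrow> 1/3 - 0"
      by (intro tendsto_intros LIMSEQ_inverse_real_of_nat)
    thus "(\<lambda>n. 1/3 - 1 / real (n + 1)) \<longlonglongrightarrow> 1/3"
      by (simp add: inverse_eq_divide)
  qed auto
  have c: "cos (2 * pi * (1 / 3)) = - 1 / 2" using cos_120 by simp
  have "isCont (\<lambda>x::real. 1 - 1 / (1 - cos (2 * pi * x))) (1 / 3)"
    by (intro continuous_intros) (use cos_120 in simp)
  from isCont_tendsto_compose[OF this lim]
  have "(\<lambda>n. 1 - 1 / (1 - cos (2 * pi * (real ((n + 1) div 3) / real (n + 1)))))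
           \<longlonglongrightarrow> 1 - 1 / (1 - cos (2 * pi * (1 / 3)))" .
  thus "(\<lambda>n. 1 - 1 / (1 - cos (2 * pi * real ((n + 1) div 3) / real (n + 1)))) \<longlonglongrightarrow> 1 / 3"
    unfolding c by (simp only: times_divide_eq_right) simp
qed

section \<open>Polynomials given by their roots\<close>

definition poly_of_roots :: "complex list \<Rightarrow> complex poly" where
  "poly_of_roots zs = (\<Prod>z\<leftarrow>zs. [:-z, 1:])"

lemma poly_of_roots_Nil [simp]: "poly_of_roots [] = 1"
  and poly_of_roots_Cons: "poly_of_roots (z # zs) = [:-z, 1:] * poly_of_roots zs"
  by (simp_all add: poly_of_roots_def)

lemma poly_poly_of_roots_Cons [simp]:
  "poly (poly_of_roots (z # zs)) w = (w - z) * poly (poly_of_roots zs) w"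
  unfolding poly_of_roots_Cons by (simp add: algebra_simps)

lemma poly_pderiv_poly_of_roots_Cons [simp]:
  "poly (pderiv (poly_of_roots (z # zs))) w =
     poly (poly_of_roots zs) w + (w - z) * poly (pderiv (poly_of_roots zs)) w"
  unfolding poly_of_roots_Cons pderiv_mult by (simp add: pderiv_pCons algebra_simps)

lemma poly_of_roots_monic: "lead_coeff (poly_of_roots zs) = 1"
  by (induction zs) (simp_all add: poly_of_roots_Cons lead_coeff_mult del: mult_pCons_left)

lemma degree_poly_of_roots [simp]: "degree (poly_of_roots zs) = length zs"
proof (induction zs)
  case (Cons z zs)
  have "poly_of_roots zs \<noteq> 0" using poly_of_roots_monic[of zs] by auto
  thus ?case using Cons by (simp add: poly_of_roots_Cons degree_mult_eq del: mult_pCons_left)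
qed simp

lemma poly_of_roots_eq_0_iff: "poly (poly_of_roots zs) w = 0 \<longleftrightarrow> w \<in> set zs"
  by (induction zs) auto

lemma ex_poly_of_roots:
  fixes p :: "complex poly"
  assumes "p \<noteq> 0"
  obtains zs where "length zs = degree p" "p = smult (lead_coeff p) (poly_of_roots zs)"
proof -
  obtain A where A: "size A = degree p" "p = smult (lead_coeff p) (\<Prod>x\<in>#A. [:-x, 1:])"
    using alg_closed_imp_factorization[OF assms] by auto
  obtain zs where "mset zs = A" using ex_mset by auto
  with A show ?thesis
    by (intro that[of zs]) (auto simp: poly_of_roots_def simp flip: prod_mset_prod_list)
qed

lemma pderiv_poly_of_roots_logarithmic:
  assumes "w \<notin> set zs"
  shows "poly (pderiv (poly_of_roots zs)) w =
         poly (poly_of_roots zs) w * (\<Sum>z\<leftarrow>zs. 1 / (w - z))"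
  using assms
proof (induction zs)
  case (Cons z zs)
  thus ?case
    by (simp add: field_simps)
qed (simp add: pderiv_1)

text \<open>
  After division by \<open>|p w|\<^sup>2\<close> this says that \<open>Re (w p'(w) / p(w)) = \<Sum> Re (w / (w - z)) \<ge> 0\<close>, and each
  summand is nonnegative for \<open>|z| \<le> 1 = |w|\<close>. The form without division needs no case distinction at
  the roots of \<open>p\<close>. It turns the location of the roots into inequalities for the values of \<open>p\<close> and
  \<open>p'\<close> at points of the circle.
\<close>
lemma Re_pderiv_poly_of_roots_nonneg:
  assumes "\<And>z. z \<in> set zs \<Longrightarrow> cmod z \<le> 1" and w: "cmod w = 1"
  shows "Re (w * poly (pderiv (poly_of_roots zs)) w * cnj (poly (poly_of_roots zs) w)) \<ge> 0"
  using assms(1)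
proof (induction zs)
  case (Cons z zs)
  let ?p = "poly (poly_of_roots zs) w" and ?p' = "poly (pderiv (poly_of_roots zs)) w"
  have "Re (w * cnj z) \<le> cmod (w * cnj z)" by (rule complex_Re_le_cmod)
  also have "\<dots> \<le> 1" using w Cons.prems[of z] by (simp add: norm_mult)
  finally have 1: "Re (w * cnj (w - z)) \<ge> 0"
    using w complex_norm_square[of w] by (simp add: right_diff_distrib)
  have 2: "Re (w * ?p' * cnj ?p) \<ge> 0" using Cons by simp
  have "w * poly (pderiv (poly_of_roots (z # zs))) w * cnj (poly (poly_of_roots (z # zs)) w) =
        (?p * cnj ?p) * (w * cnj (w - z)) + ((w - z) * cnj (w - z)) * (w * ?p' * cnj ?p)"
    by (simp add: algebra_simps)
  also have "Re \<dots> = (cmod ?p)\<^sup>2 * Re (w * cnj (w - z)) +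
                   (cmod (w - z))\<^sup>2 * Re (w * ?p' * cnj ?p)"
    by (simp only: complex_norm_square[symmetric]) simp
  finally show ?case using 1 2 by simp
qed (simp add: pderiv_1)

section \<open>Coefficients with small, nearly imaginary roots\<close>

text \<open>
  The coefficient of \<open>X ^ k\<close> is the elementary symmetric function of degree \<open>k\<close> of the roots up to
  the sign \<open>(-1) ^ k\<close>. With the reversed polynomial the index \<open>k\<close> does not depend on the number of
  roots, which suits induction on the list.
\<close>
definition rev_poly_of_roots :: "complex list \<Rightarrow> complex poly" where
  "rev_poly_of_roots zs = (\<Prod>z\<leftarrow>zs. [:1, -z:])"

abbreviation root_coeff :: "complex list \<Rightarrow> nat \<Rightarrow> complex" where
  "root_coeff zs k \<equiv> coeff (rev_poly_of_roots zs) k"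

lemma rev_poly_of_roots_simps [simp]:
  "rev_poly_of_roots [] = 1" "rev_poly_of_roots (z # zs) = [:1, -z:] * rev_poly_of_roots zs"
  by (simp_all add: rev_poly_of_roots_def)

lemma reflect_poly_of_roots: "reflect_poly (poly_of_roots zs) = rev_poly_of_roots zs"
proof -
  have "reflect_poly [:-z, 1:] = [:1, -z:]" for z :: complex
    by (simp add: reflect_poly_def)
  thus ?thesis by (induction zs) (simp_all add: poly_of_roots_Cons reflect_poly_mult del: mult_pCons_left)
qed

lemma coeff_poly_of_roots:
  assumes "k \<le> length zs"
  shows "coeff (poly_of_roots zs) (length zs - k) = root_coeff zs k"
  using assms by (simp flip: reflect_poly_of_roots add: coeff_reflect_poly)

lemma root_coeff_0 [simp]: "root_coeff zs 0 = 1"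
  by (induction zs) (simp_all add: coeff_mult)

lemma root_coeff_Cons_Suc:
  "root_coeff (z # zs) (Suc k) = root_coeff zs (Suc k) - z * root_coeff zs k"
  by simp

lemma root_coeff_1: "root_coeff zs 1 = - sum_list zs"
  by (induction zs) (simp_all add: algebra_simps)

lemma root_coeff_2: "2 * root_coeff zs 2 = (sum_list zs)\<^sup>2 - (\<Sum>z\<leftarrow>zs. z\<^sup>2)"
proof (induction zs)
  case (Cons z zs)
  have "2 * root_coeff (z # zs) 2 = 2 * root_coeff zs 2 - 2 * z * root_coeff zs 1"
    unfolding numeral_2_eq_2 One_nat_def root_coeff_Cons_Suc by (simp add: algebra_simps)
  also have "\<dots> = (sum_list zs)\<^sup>2 - (\<Sum>z\<leftarrow>zs. z\<^sup>2) + 2 * z * sum_list zs"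
    unfolding Cons.IH root_coeff_1 by simp
  also have "\<dots> = (sum_list (z # zs))\<^sup>2 - (\<Sum>z\<leftarrow>z # zs. z\<^sup>2)"
    by (simp add: power2_eq_square algebra_simps)
  finally show ?case .
qed simp

text \<open>
  A product of \<open>k\<close> roots is of size \<open>\<eta> ^ k\<close>, and it is nearly \<open>\<i> ^ k\<close> times a real number, because
  the real part of each root is smaller than its imaginary part by a further factor \<open>\<eta>\<close>. Hence one
  of the two parts gains this factor, depending on the parity of \<open>k\<close>. In particular the real parts
  are at most of order \<open>\<eta> ^ 4\<close> from \<open>k = 3\<close> on.
\<close>
lemma root_coeff_parity_bounds:
  fixes M \<eta> :: real
  assumes "\<And>z. z \<in> set zs \<Longrightarrow> \<bar>Re z\<bar> \<le> M * \<eta>\<^sup>2" "\<And>z. z \<in> set zs \<Longrightarrow> \<bar>Im z\<bar> \<le> M * \<eta>"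
    and M: "0 \<le> M" and \<eta>: "0 \<le> \<eta>" "\<eta> \<le> 1"
  defines "D \<equiv> (1 + 2 * M) ^ length zs"
  shows "\<bar>Re (root_coeff zs k)\<bar> \<le> D * \<eta> ^ (if even k then k else k + 1)"
    and "\<bar>Im (root_coeff zs k)\<bar> \<le> D * \<eta> ^ (if even k then k + 1 else k)"
proof -
  have "\<bar>Re (root_coeff zs k)\<bar> \<le> (1 + 2 * M) ^ length zs * \<eta> ^ (if even k then k else k + 1) \<and>
        \<bar>Im (root_coeff zs k)\<bar> \<le> (1 + 2 * M) ^ length zs * \<eta> ^ (if even k then k + 1 else k)"
    using assms(1,2)
  proof (induction zs arbitrary: k)
    case Nil
    show ?case using \<eta> by (cases k) auto
  next
    case (Cons z zs)
    let ?D = "(1 + 2 * M) ^ length zs"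
    let ?r = "\<lambda>k::nat. if even k then k else k + 1" and ?i = "\<lambda>k::nat. if even k then k + 1 else k"
    have D: "?D \<ge> 0" using M by simp
    have IH: "\<bar>Re (root_coeff zs k)\<bar> \<le> ?D * \<eta> ^ ?r k" "\<bar>Im (root_coeff zs k)\<bar> \<le> ?D * \<eta> ^ ?i k" for k
      using Cons.IH[of k] Cons.prems by auto
    have z: "\<bar>Re z\<bar> \<le> M * \<eta>\<^sup>2" "\<bar>Im z\<bar> \<le> M * \<eta>" using Cons.prems by auto
    show ?case
    proof (cases k)
      case 0
      have "1 \<le> (1 + 2 * M) ^ length (z # zs)" by (rule one_le_power) (use M in simp)
      thus ?thesis using 0 \<eta> M by simp
    next
      case (Suc j)
      have pw: "\<eta> ^ a \<le> \<eta> ^ b" if "b \<le> a" for a b using \<eta> that by (rule power_decreasing[rotated 1])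
      have prod_bound: "\<bar>x * y\<bar> \<le> M * ?D * \<eta> ^ c"
        if "\<bar>x\<bar> \<le> M * \<eta> ^ a" "\<bar>y\<bar> \<le> ?D * \<eta> ^ b" "c \<le> a + b" for x y a b c
      proof -
        have "\<bar>x * y\<bar> \<le> (M * \<eta> ^ a) * (?D * \<eta> ^ b)"
          unfolding abs_mult using that M \<eta> by (intro mult_mono) auto
        also have "\<dots> = M * ?D * \<eta> ^ (a + b)" by (simp add: power_add)
        also have "\<dots> \<le> M * ?D * \<eta> ^ c" using M D that by (intro mult_left_mono pw) auto
        finally show ?thesis .
      qed
      have z': "\<bar>Re z\<bar> \<le> M * \<eta> ^ 2" "\<bar>Im z\<bar> \<le> M * \<eta> ^ 1" using z by auto
      have "\<bar>Re z * Re (root_coeff zs j)\<bar> \<le> M * ?D * \<eta> ^ ?r k"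
        by (rule prod_bound[OF z'(1) IH(1)]) (auto simp: Suc)
      moreover have "\<bar>Im z * Im (root_coeff zs j)\<bar> \<le> M * ?D * \<eta> ^ ?r k"
        by (rule prod_bound[OF z'(2) IH(2)]) (auto simp: Suc)
      moreover have "\<bar>Re z * Im (root_coeff zs j)\<bar> \<le> M * ?D * \<eta> ^ ?i k"
        by (rule prod_bound[OF z'(1) IH(2)]) (auto simp: Suc)
      moreover have "\<bar>Im z * Re (root_coeff zs j)\<bar> \<le> M * ?D * \<eta> ^ ?i k"
        by (rule prod_bound[OF z'(2) IH(1)]) (auto simp: Suc)
      moreover have e: "(1 + 2 * M) ^ length (z # zs) * x = ?D * x + M * ?D * x + M * ?D * x" for x
        by (simp add: algebra_simps)
      moreover have "Re (root_coeff (z # zs) k) =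
          Re (root_coeff zs k) - (Re z * Re (root_coeff zs j) - Im z * Im (root_coeff zs j))"
        "Im (root_coeff (z # zs) k) =
          Im (root_coeff zs k) - (Re z * Im (root_coeff zs j) + Im z * Re (root_coeff zs j))"
        unfolding Suc root_coeff_Cons_Suc by simp_all
      ultimately show ?thesis unfolding e using IH[of k] by (intro conjI; linarith)
    qed
  qed
  thus "\<bar>Re (root_coeff zs k)\<bar> \<le> D * \<eta> ^ (if even k then k else k + 1)"
    "\<bar>Im (root_coeff zs k)\<bar> \<le> D * \<eta> ^ (if even k then k + 1 else k)"
    unfolding D_def by auto
qed

section \<open>A monic polynomial in terms of its critical points\<close>

lemma poly_via_critical_points:
  fixes P :: "complex poly"
  assumes P: "degree P = n + 1" "pderiv P = smult (of_nat (n + 1)) (poly_of_roots \<zeta>)"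
    and len: "length \<zeta> = n"
  shows "poly P w - poly P b = of_nat (n + 1) *
           (\<Sum>k\<le>n. root_coeff \<zeta> k / of_nat (n + 1 - k) * (w ^ (n + 1 - k) - b ^ (n + 1 - k)))"
proof -
  have c: "coeff P (Suc i) = of_nat (n + 1) * coeff (poly_of_roots \<zeta>) i / of_nat (Suc i)" for i
  proof -
    have "of_nat (Suc i) * coeff P (Suc i) = coeff (pderiv P) i" by (simp add: coeff_pderiv)
    also have "\<dots> = of_nat (n + 1) * coeff (poly_of_roots \<zeta>) i" by (simp add: P)
    finally show ?thesis by (simp add: field_simps del: of_nat_Suc)
  qed
  have val: "poly P x = coeff P 0 + (\<Sum>i\<le>n. coeff P (Suc i) * x ^ Suc i)" for x
    using P(1) by (simp add: poly_altdef sum.atMost_Suc_shift del: sum.atMost_Suc)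
  have "poly P w - poly P b = (\<Sum>i\<le>n. coeff P (Suc i) * (w ^ Suc i - b ^ Suc i))"
    unfolding val by (simp add: sum_subtractf right_diff_distrib)
  also have "\<dots> = (\<Sum>k\<le>n. coeff P (Suc (n - k)) * (w ^ Suc (n - k) - b ^ Suc (n - k)))"
    by (rule sum.reindex_bij_witness[of _ "\<lambda>k. n - k" "\<lambda>k. n - k"]) auto
  also have "\<dots> = (\<Sum>k\<le>n. of_nat (n + 1) * (root_coeff \<zeta> k / of_nat (n + 1 - k) *
                     (w ^ (n + 1 - k) - b ^ (n + 1 - k))))"
  proof (intro sum.cong refl)
    fix k assume "k \<in> {..n}"
    hence k: "k \<le> n" by simp
    hence "coeff (poly_of_roots \<zeta>) (n - k) = root_coeff \<zeta> k"
      using coeff_poly_of_roots[of k \<zeta>] len by simp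
    thus "coeff P (Suc (n - k)) * (w ^ Suc (n - k) - b ^ Suc (n - k)) =
        of_nat (n + 1) * (root_coeff \<zeta> k / of_nat (n + 1 - k) * (w ^ (n + 1 - k) - b ^ (n + 1 - k)))"
      using k by (simp add: c Suc_diff_le del: of_nat_Suc power_Suc)
  qed
  finally show ?thesis by (simp only: sum_distrib_left)
qed

lemma poly_of_roots_rev_sum:
  assumes "length \<zeta> = n"
  shows "w * poly (poly_of_roots \<zeta>) w = (\<Sum>k\<le>n. root_coeff \<zeta> k * w ^ (n + 1 - k))"
proof -
  have "w * poly (poly_of_roots \<zeta>) w = (\<Sum>i\<le>n. coeff (poly_of_roots \<zeta>) i * w ^ Suc i)"
    by (simp add: poly_altdef assms sum_distrib_left mult_ac)
  also have "\<dots> = (\<Sum>k\<le>n. coeff (poly_of_roots \<zeta>) (n - k) * w ^ Suc (n - k))"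
    by (rule sum.reindex_bij_witness[of _ "\<lambda>k. n - k" "\<lambda>k. n - k"]) auto
  also have "\<dots> = (\<Sum>k\<le>n. root_coeff \<zeta> k * w ^ (n + 1 - k))"
    using coeff_poly_of_roots[of _ \<zeta>] assms
    by (intro sum.cong) (auto simp: Suc_diff_le simp del: power_Suc)
  finally show ?thesis .
qed

section \<open>Critical points close to the origin\<close>

lemma norm_poly_of_roots_ge:
  assumes "\<And>z. z \<in> set zs \<Longrightarrow> c \<le> cmod (w - z)" "0 \<le> c"
  shows "c ^ length zs \<le> cmod (poly (poly_of_roots zs) w)"
  using assms(1)
proof (induction zs)
  case (Cons z zs)
  thus ?case using \<open>0 \<le> c\<close> by (auto simp: norm_mult intro!: mult_mono)
qed simp

lemma norm_poly_of_roots_le: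
  assumes "\<And>z. z \<in> set zs \<Longrightarrow> cmod (w - z) \<le> c"
  shows "cmod (poly (poly_of_roots zs) w) \<le> c ^ length zs"
  using assms
proof (induction zs)
  case (Cons z zs)
  have "0 \<le> c" using Cons.prems by (meson list.set_intros(1) norm_ge_zero order_trans)
  with Cons show ?case by (auto simp: norm_mult intro!: mult_mono)
qed simp

lemma norm_poly_of_roots_le_factor:
  assumes "\<And>z. z \<in> set zs \<Longrightarrow> cmod (w - z) \<le> c" and x: "x \<in> set zs"
  shows "cmod (poly (poly_of_roots zs) w) \<le> cmod (w - x) * c ^ (length zs - 1)"
proof -
  obtain ys where ys: "mset zs = mset (x # ys)"
    using x by (metis ex_mset insert_DiffM mset.simps(2) set_mset_mset)
  have "poly_of_roots zs = poly_of_roots (x # ys)"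
    unfolding poly_of_roots_def using ys by (metis mset_map prod_mset_prod_list)
  moreover have "length zs = length ys + 1" "set ys \<subseteq> set zs"
    using ys by (metis Suc_eq_plus1 length_Cons size_mset, metis mset_eq_setD set_subset_Cons)
  ultimately show ?thesis
    using norm_poly_of_roots_le[of ys w c] assms(1)
    by (auto simp: norm_mult subset_iff intro!: mult_left_mono)
qed

text \<open>
  For \<open>\<beta> = 1\<close> this is the half-plane \<open>Re \<ge> 1/2\<close>, the image of the disk under \<open>z \<mapsto> 1 / (1 - z)\<close>. For
  \<open>\<beta> < 1\<close> the disk contains the pole, and a bound is possible only for \<open>z\<close> away from it.
\<close>
lemma Re_inverse_ge:
  assumes "0 \<le> \<beta>" "\<beta> \<le> 1" "cmod z \<le> 1" "c > 0" "c \<le> cmod (of_real \<beta> - z)"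
  shows "Re (1 / (of_real \<beta> - z)) \<ge> 1 / 2 - 3 / (2 * c\<^sup>2) * (1 - \<beta>)"
proof -
  define N where "N = (cmod (of_real \<beta> - z))\<^sup>2"
  have N: "N \<ge> c\<^sup>2" unfolding N_def using assms by (intro power_mono) auto
  have c2: "c\<^sup>2 > 0" using assms by simp
  have "(cmod z)\<^sup>2 \<le> 1" using assms(3) by (simp add: power_le_one)
  hence z: "(Re z)\<^sup>2 + (Im z)\<^sup>2 \<le> 1" by (simp add: cmod_power2)
  have NN: "N = (\<beta> - Re z)\<^sup>2 + (Im z)\<^sup>2" by (simp add: N_def cmod_power2)
  have "Re z \<le> 1" using assms(3) complex_Re_le_cmod[of z] by linarith
  hence 1: "Re z * (1 - \<beta>) \<le> 1 * (1 - \<beta>)" using assms by (intro mult_right_mono) auto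
  have 2: "(1 - \<beta>) * (1 - \<beta>) \<le> 1 * (1 - \<beta>)" using assms by (intro mult_right_mono) auto
  have "2 * (\<beta> - Re z) - N = (1 - ((Re z)\<^sup>2 + (Im z)\<^sup>2)) - (1 - \<beta>) * (1 - \<beta>) - 2 * (Re z * (1 - \<beta>))"
    unfolding NN by (simp add: power2_eq_square algebra_simps)
  hence 3: "2 * (\<beta> - Re z) \<ge> N - 3 * (1 - \<beta>)" using 1 2 z by linarith
  have 4: "N / 2 - 3 / 2 * (1 - \<beta>) \<le> \<beta> - Re z" using 3 by (simp add: field_simps)
  have N0: "0 < N" using N c2 by linarith
  have "Re (1 / (of_real \<beta> - z)) = (\<beta> - Re z) / N"
    unfolding N_def by (simp add: Re_divide cmod_power2)
  also have "\<dots> \<ge> (N / 2 - 3 / 2 * (1 - \<beta>)) / N"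
    using 4 N0 by (intro divide_right_mono) auto
  also have "(N / 2 - 3 / 2 * (1 - \<beta>)) / N = 1 / 2 - (3 / 2 * (1 - \<beta>)) / N"
    using N0 by (simp add: diff_divide_distrib)
  finally have "Re (1 / (of_real \<beta> - z)) \<ge> 1 / 2 - (3 / 2 * (1 - \<beta>)) / N" .
  moreover have "(3 / 2 * (1 - \<beta>)) / N \<le> (3 / 2 * (1 - \<beta>)) / c\<^sup>2"
    using N N0 c2 assms by (intro frac_le) auto
  ultimately show ?thesis by simp
qed

lemma sum_list_each_ge:
  fixes f :: "'a \<Rightarrow> real"
  assumes "\<And>x. x \<in> set xs \<Longrightarrow> f x \<le> b" and y: "y \<in> set xs"
  shows "f y \<ge> sum_list (map f xs) - (real (length xs) - 1) * b"
proof -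
  obtain us vs where xs: "xs = us @ y # vs" using split_list[OF y] by auto
  have le: "sum_list (map f ws) \<le> real (length ws) * b" if "set ws \<subseteq> set xs" for ws
    using that
  proof (induction ws)
    case (Cons w ws)
    thus ?case using assms(1)[of w] by (simp add: algebra_simps)
  qed simp
  have "sum_list (map f us) \<le> real (length us) * b" "sum_list (map f vs) \<le> real (length vs) * b"
    by (rule le, force simp: xs)+
  thus ?thesis by (simp add: xs algebra_simps)
qed

text \<open>
  If \<open>1 / u\<close> has modulus at most \<open>1 / (1 - \<epsilon>)\<close> and real part at least \<open>1 - O(\<epsilon>)\<close>, it is confined to a
  thin circular segment near \<open>1\<close>, of width \<open>O(\<epsilon>)\<close> and height \<open>O(sqrt \<epsilon>)\<close>, and so is \<open>u\<close>.
\<close>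
lemma almost_unit_inverse:
  fixes u :: complex
  assumes \<epsilon>: "0 \<le> \<epsilon>" "\<epsilon> \<le> 1" and B: "B \<ge> 1" "B * \<epsilon> \<le> 1 / 2"
    and u: "1 - \<epsilon> \<le> cmod u" "Re (1 / u) \<ge> 1 - B * \<epsilon>"
  shows "cmod u \<le> 1 + 2 * B * \<epsilon>" "\<bar>1 - \<epsilon> - Re u\<bar> \<le> (2 * B + 1) * \<epsilon>"
    "(Im u)\<^sup>2 \<le> (12 * B + 8) * \<epsilon>"
proof -
  define s where "s = cmod u"
  have "Re (1 / u) > 0" using u B by linarith
  hence u0: "u \<noteq> 0" by auto
  hence s: "s > 0" by (simp add: s_def)
  have "Re (1 / u) = Re u / s\<^sup>2" by (simp add: s_def Re_divide cmod_power2)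
  with u(2) s have R: "Re u \<ge> (1 - B * \<epsilon>) * s\<^sup>2" by (simp add: pos_le_divide_eq)
  have Rs: "Re u \<le> s" unfolding s_def by (rule complex_Re_le_cmod)
  from R Rs have "(1 - B * \<epsilon>) * s * s \<le> 1 * s" by (simp add: power2_eq_square mult.assoc)
  hence "(1 - B * \<epsilon>) * s \<le> 1" using s by (rule mult_right_le_imp_le)
  moreover have "(1 - B * \<epsilon>) * (1 + 2 * (B * \<epsilon>)) \<ge> 1"
  proof -
    have "(B * \<epsilon>) * (B * \<epsilon>) \<le> 1/2 * (B * \<epsilon>)" using B \<epsilon> by (intro mult_right_mono) auto
    thus ?thesis by (simp add: algebra_simps)
  qed
  ultimately have "(1 - B * \<epsilon>) * s \<le> (1 - B * \<epsilon>) * (1 + 2 * (B * \<epsilon>))" by linarith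
  hence s_le: "s \<le> 1 + 2 * (B * \<epsilon>)" using B by (subst (asm) mult_le_cancel_left) auto
  thus "cmod u \<le> 1 + 2 * B * \<epsilon>" by (simp add: s_def)
  have "(1 - \<epsilon>)\<^sup>2 \<le> s\<^sup>2" using u \<epsilon> by (intro power_mono) (auto simp: s_def)
  hence "(1 - B * \<epsilon>) * (1 - \<epsilon>)\<^sup>2 \<le> (1 - B * \<epsilon>) * s\<^sup>2" using B by (intro mult_left_mono) auto
  moreover have "(1 - B * \<epsilon>) * (1 - 2 * \<epsilon>) \<le> (1 - B * \<epsilon>) * (1 - \<epsilon>)\<^sup>2"
    using B by (intro mult_left_mono) (auto simp: power2_eq_square algebra_simps)
  moreover have "(1 - B * \<epsilon>) * (1 - 2 * \<epsilon>) \<ge> 1 - B * \<epsilon> - 2 * \<epsilon>"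
    using B \<epsilon> by (simp add: algebra_simps)
  ultimately have R2: "Re u \<ge> 1 - B * \<epsilon> - 2 * \<epsilon>" using R by linarith
  have \<epsilon>B: "\<epsilon> \<le> B * \<epsilon>" using B \<epsilon> by (simp add: mult_le_cancel_right1)
  show "\<bar>1 - \<epsilon> - Re u\<bar> \<le> (2 * B + 1) * \<epsilon>"
    using R2 Rs s_le \<epsilon>B \<epsilon> by (simp add: algebra_simps abs_le_iff)
  have "(Im u)\<^sup>2 = (s - Re u) * (s + Re u)"
    by (simp add: s_def cmod_power2 algebra_simps flip: power2_eq_square)
  also have "\<dots> \<le> (3 * (B * \<epsilon>) + 2 * \<epsilon>) * 4"
  proof (rule mult_mono)
    have "0 \<le> (1 - B * \<epsilon>) * s\<^sup>2" using B by (intro mult_nonneg_nonneg) auto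
    moreover have "0 \<le> B * \<epsilon>" using B \<epsilon> by simp
    ultimately show "s - Re u \<le> 3 * (B * \<epsilon>) + 2 * \<epsilon>" "s + Re u \<le> 4" "0 \<le> 3 * (B * \<epsilon>) + 2 * \<epsilon>" "0 \<le> s + Re u"
      using R R2 Rs s_le s B \<epsilon> by linarith+
  qed
  finally show "(Im u)\<^sup>2 \<le> (12 * B + 8) * \<epsilon>" by (simp add: algebra_simps)
qed

text \<open>
  Comparing \<open>P''(\<beta>) / P'(\<beta>)\<close>, computed from the other roots \<open>z\<close> of \<open>P\<close> and from the critical points,
  gives \<open>\<Sum> 1 / (\<beta> - \<zeta>) = 2 \<Sum> 1 / (\<beta> - z)\<close>. The right-hand side has real part at least \<open>n - O(\<epsilon>)\<close>,
  while each of the \<open>n\<close> summands on the left has modulus at most \<open>1 / \<beta> = 1 + O(\<epsilon>)\<close>; hence each of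
  them has real part \<open>1 + O(\<epsilon>)\<close>.
\<close>
lemma critical_points_near_zero:
  fixes n :: nat
  assumes n: "n \<ge> 1"
  obtains M \<epsilon>\<^sub>0 :: real where "M \<ge> 1" "0 < \<epsilon>\<^sub>0" "\<epsilon>\<^sub>0 \<le> 1 / 2"
    "\<And>\<beta> zs \<zeta> x. \<lbrakk>1 - \<epsilon>\<^sub>0 < \<beta>; \<beta> < 1; length zs = n; \<And>z. z \<in> set zs \<Longrightarrow> cmod z \<le> 1;
       length \<zeta> = n;
       pderiv (poly_of_roots (of_real \<beta> # zs)) = smult (of_nat (n + 1)) (poly_of_roots \<zeta>);
       \<And>x. x \<in> set \<zeta> \<Longrightarrow> \<beta> \<le> cmod (of_real \<beta> - x); x \<in> set \<zeta>\<rbrakk> \<Longrightarrow>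
       \<bar>Re x\<bar> \<le> M * (1 - \<beta>) \<and> \<bar>Im x\<bar> \<le> M * sqrt (1 - \<beta>) \<and> cmod (of_real \<beta> - x) \<le> 1 + M * (1 - \<beta>)"
proof -
  define c :: real where "c = (1 / 4) ^ n"
  define B where "B = 3 * real n / c\<^sup>2 + 2 * real n"
  define M where "M = 12 * B + 8"
  have c: "c > 0" by (simp add: c_def)
  have B: "B \<ge> 1"
  proof -
    have "0 \<le> 3 * real n / c\<^sup>2" by simp
    thus ?thesis using n unfolding B_def by linarith
  qed
  have main: "\<bar>Re x\<bar> \<le> M * (1 - \<beta>) \<and> \<bar>Im x\<bar> \<le> M * sqrt (1 - \<beta>) \<and>
      cmod (of_real \<beta> - x) \<le> 1 + M * (1 - \<beta>)"
    if \<beta>: "1 - 1 / (2 * B) < \<beta>" "\<beta> < 1" and zs: "length zs = n" "\<And>z. z \<in> set zs \<Longrightarrow> cmod z \<le> 1"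
      and \<zeta>: "length \<zeta> = n"
        "pderiv (poly_of_roots (of_real \<beta> # zs)) = smult (of_nat (n + 1)) (poly_of_roots \<zeta>)"
        "\<And>x. x \<in> set \<zeta> \<Longrightarrow> \<beta> \<le> cmod (of_real \<beta> - x)" and x: "x \<in> set \<zeta>"
    for \<beta> zs \<zeta> x
  proof -
    define \<epsilon> where "\<epsilon> = 1 - \<beta>"
    define b :: complex where "b = of_real \<beta>"
    have "1 / (2 * B) \<le> 1 / 2" using B by (simp add: field_simps)
    hence \<beta>2: "\<beta> \<ge> 1 / 2" using \<beta> by linarith
    have \<epsilon>: "0 < \<epsilon>" "\<epsilon> \<le> 1" "B * \<epsilon> \<le> 1 / 2"
    proof -
      have "\<epsilon> \<le> 1 / (2 * B)" using \<beta> by (simp add: \<epsilon>_def)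
      thus "B * \<epsilon> \<le> 1 / 2" using B by (simp add: field_simps)
    qed (use \<beta> \<beta>2 in \<open>auto simp: \<epsilon>_def\<close>)
    \<comment> \<open>The other roots of \<open>P\<close> stay away from \<open>\<beta>\<close>, because the product of their distances to \<open>\<beta>\<close>
      is \<open>|P'(\<beta>)|\<close>, which is \<open>n + 1\<close> times the product of the distances of the critical points.\<close>
    have val: "poly (poly_of_roots zs) b = of_nat (n + 1) * poly (poly_of_roots \<zeta>) b"
    proof -
      have "poly (poly_of_roots zs) b = poly (pderiv (poly_of_roots (b # zs))) b" by simp
      also have "\<dots> = of_nat (n + 1) * poly (poly_of_roots \<zeta>) b"
        using \<zeta>(2) by (simp add: b_def)
      finally show ?thesis .
    qed
    have "(1 / 2) ^ n \<le> cmod (poly (poly_of_roots \<zeta>) b)"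
      using norm_poly_of_roots_ge[of \<zeta> "1/2" b] \<zeta>(1,3) \<beta>2 by (force simp: b_def)
    also have "\<dots> \<le> real (n + 1) * cmod (poly (poly_of_roots \<zeta>) b)"
      by (simp add: mult_le_cancel_right1)
    also have "\<dots> = cmod (poly (poly_of_roots zs) b)" by (simp add: val norm_mult del: of_nat_Suc of_nat_add)
    finally have big: "(1 / 2) ^ n \<le> cmod (poly (poly_of_roots zs) b)" .
    have sep: "c \<le> cmod (b - z)" if "z \<in> set zs" for z
    proof -
      have "cmod (b - y) \<le> 2" if "y \<in> set zs" for y
        using norm_triangle_ineq4[of b y] zs(2)[OF that] \<beta> \<beta>2 by (simp add: b_def)
      hence "cmod (poly (poly_of_roots zs) b) \<le> cmod (b - z) * 2 ^ (n - 1)"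
        using norm_poly_of_roots_le_factor[of zs b 2 z] that zs by auto
      also have "\<dots> \<le> cmod (b - z) * 2 ^ n" by (intro mult_left_mono power_increasing) auto
      finally have "(1 / 2) ^ n \<le> cmod (b - z) * 2 ^ n" using big by linarith
      hence "(1 / 2) ^ n * (1 / 2) ^ n \<le> cmod (b - z) * 2 ^ n * (1 / 2) ^ n"
        by (intro mult_right_mono) auto
      moreover have "(1 / 2) ^ n * (1 / 2) ^ n = c"
        by (simp add: c_def flip: power_mult_distrib)
      moreover have "cmod (b - z) * 2 ^ n * (1 / 2) ^ n = cmod (b - z)"
        by (simp add: power_one_over)
      ultimately show ?thesis by simp
    qed
    have bzs: "b \<notin> set zs" using sep[of b] c by auto
    have b\<zeta>: "b \<notin> set \<zeta>" using \<zeta>(3)[of b] \<beta>2 by (auto simp: b_def)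
    have nz: "poly (poly_of_roots zs) b \<noteq> 0" using bzs by (simp add: poly_of_roots_eq_0_iff)
    have "poly (pderiv (pderiv (poly_of_roots (b # zs)))) b = 2 * poly (pderiv (poly_of_roots zs)) b"
      unfolding poly_of_roots_Cons pderiv_mult pderiv_add by (simp add: pderiv_pCons)
    moreover have "poly (pderiv (pderiv (poly_of_roots (b # zs)))) b =
        of_nat (n + 1) * poly (pderiv (poly_of_roots \<zeta>)) b"
      using \<zeta>(2) by (simp add: b_def pderiv_smult)
    ultimately have "2 * (poly (poly_of_roots zs) b * (\<Sum>z\<leftarrow>zs. 1 / (b - z))) =
        of_nat (n + 1) * (poly (poly_of_roots \<zeta>) b * (\<Sum>z\<leftarrow>\<zeta>. 1 / (b - z)))"
      using pderiv_poly_of_roots_logarithmic[OF bzs] pderiv_poly_of_roots_logarithmic[OF b\<zeta>] by simp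
    hence "poly (poly_of_roots zs) b * (2 * (\<Sum>z\<leftarrow>zs. 1 / (b - z))) =
        poly (poly_of_roots zs) b * (\<Sum>z\<leftarrow>\<zeta>. 1 / (b - z))"
      unfolding val by (simp only: mult_ac)
    hence "(\<Sum>z\<leftarrow>\<zeta>. 1 / (b - z)) = 2 * (\<Sum>z\<leftarrow>zs. 1 / (b - z))" using nz by simp
    hence "Re (\<Sum>z\<leftarrow>\<zeta>. 1 / (b - z)) = 2 * Re (\<Sum>z\<leftarrow>zs. 1 / (b - z))" by simp
    moreover have "Re (\<Sum>z\<leftarrow>xs. 1 / (b - z)) = (\<Sum>z\<leftarrow>xs. Re (1 / (b - z)))" for xs
      by (induction xs) auto
    ultimately have S: "(\<Sum>z\<leftarrow>\<zeta>. Re (1 / (b - z))) = 2 * (\<Sum>z\<leftarrow>zs. Re (1 / (b - z)))"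
      by simp
    have "(\<Sum>z\<leftarrow>zs. 1 / 2 - 3 / (2 * c\<^sup>2) * \<epsilon>) \<le> (\<Sum>z\<leftarrow>zs. Re (1 / (b - z)))"
      unfolding b_def \<epsilon>_def using \<beta> \<beta>2 zs(2) c sep
      by (intro sum_list_mono Re_inverse_ge) (auto simp: b_def)
    hence S2: "(\<Sum>z\<leftarrow>\<zeta>. Re (1 / (b - z))) \<ge> real n - 3 * real n / c\<^sup>2 * \<epsilon>"
      unfolding S using zs(1) by (simp add: sum_list_triv algebra_simps)
    have up: "Re (1 / (b - y)) \<le> 1 + 2 * \<epsilon>" if "y \<in> set \<zeta>" for y
    proof -
      have "Re (1 / (b - y)) \<le> cmod (1 / (b - y))" by (rule complex_Re_le_cmod)
      also have "\<dots> = 1 / cmod (b - y)" by (simp add: norm_divide)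
      also have "\<dots> \<le> 1 / \<beta>" using \<zeta>(3)[OF that] \<beta>2 by (intro frac_le) (auto simp: b_def)
      also have "\<dots> \<le> 1 + 2 * \<epsilon>"
      proof -
        have "1 / 2 * \<epsilon> \<le> \<beta> * \<epsilon>" using \<beta>2 \<epsilon> by (intro mult_right_mono) auto
        moreover have "\<beta> + \<epsilon> = 1" by (simp add: \<epsilon>_def)
        ultimately have "1 \<le> \<beta> + 2 * (\<beta> * \<epsilon>)" by linarith
        hence "1 \<le> (1 + 2 * \<epsilon>) * \<beta>" by (simp add: algebra_simps)
        thus ?thesis using \<beta>2 by (simp add: pos_divide_le_eq)
      qed
      finally show ?thesis .
    qed
    have "Re (1 / (b - x)) \<ge> (\<Sum>z\<leftarrow>\<zeta>. Re (1 / (b - z))) - (real (length \<zeta>) - 1) * (1 + 2 * \<epsilon>)"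
      by (rule sum_list_each_ge[of \<zeta> "\<lambda>z. Re (1 / (b - z))"]) (use up x in auto)
    hence "Re (1 / (b - x)) \<ge> (real n - 3 * real n / c\<^sup>2 * \<epsilon>) - (real n - 1) * (1 + 2 * \<epsilon>)"
      using S2 \<zeta>(1) by simp
    also have "(real n - 3 * real n / c\<^sup>2 * \<epsilon>) - (real n - 1) * (1 + 2 * \<epsilon>) = 1 - B * \<epsilon> + 2 * \<epsilon>"
      unfolding B_def by (simp add: algebra_simps)
    finally have low: "Re (1 / (b - x)) \<ge> 1 - B * \<epsilon>" using \<epsilon> by simp
    have "1 - \<epsilon> \<le> cmod (b - x)" using \<zeta>(3)[OF x] by (simp add: b_def \<epsilon>_def)
    note * = almost_unit_inverse[OF less_imp_le[OF \<epsilon>(1)] \<epsilon>(2) B \<epsilon>(3) this low]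
    have MB: "2 * B * \<epsilon> \<le> M * \<epsilon>" "(2 * B + 1) * \<epsilon> \<le> M * \<epsilon>"
      using B \<epsilon> by (intro mult_right_mono; simp add: M_def)+
    have "(Im x)\<^sup>2 \<le> M * \<epsilon>" using *(3) by (simp add: b_def M_def)
    also have "\<dots> \<le> M\<^sup>2 * \<epsilon>" using B \<epsilon> by (intro mult_right_mono) (auto simp: M_def power2_eq_square)
    finally have "sqrt ((Im x)\<^sup>2) \<le> sqrt (M\<^sup>2 * \<epsilon>)" by (rule real_sqrt_le_mono)
    also have "\<dots> = M * sqrt \<epsilon>" using B by (simp add: real_sqrt_mult M_def)
    finally have "\<bar>Im x\<bar> \<le> M * sqrt \<epsilon>" by simp
    moreover have "\<bar>Re x\<bar> \<le> M * \<epsilon>" using *(2) MB by (simp add: b_def \<epsilon>_def)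
    moreover have "cmod (b - x) \<le> 1 + M * \<epsilon>" using *(1) MB by simp
    ultimately show ?thesis by (simp add: b_def \<epsilon>_def)
  qed
  show ?thesis
  proof (rule that[of M "1 / (2 * B)"])
    show "M \<ge> 1" "0 < 1 / (2 * B)" "1 / (2 * B) \<le> 1 / 2" using B by (auto simp: M_def field_simps)
  qed (rule main; assumption)
qed

section \<open>The disk condition at the roots of unity\<close>

text \<open>
  If the coefficients of \<open>P\<close> differ from those of \<open>z ^ N - 1\<close> by \<open>O(\<rho>)\<close>, then at a root of unity \<open>w\<close>
  both \<open>P w\<close> and \<open>w P'(w) - N\<close> are \<open>O(\<rho>)\<close>, so that \<open>Re (w P'(w) cnj (P w)) \<ge> 0\<close> becomes
  \<open>N Re (P w) \<ge> - O(\<rho>\<^sup>2)\<close>.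
\<close>
lemma Re_poly_at_unity_root_ge:
  fixes n :: nat and D \<rho> :: real
  assumes P: "P = poly_of_roots zs" "length zs = n + 1" "\<And>z. z \<in> set zs \<Longrightarrow> cmod z \<le> 1"
    and P': "pderiv P = smult (of_nat (n + 1)) (poly_of_roots \<zeta>)" "length \<zeta> = n"
    and \<beta>: "poly P (of_real \<beta>) = 0" "0 \<le> \<beta>" "\<beta> \<le> 1" "1 - \<beta> \<le> \<rho>"
    and D: "0 \<le> D" "\<And>k. 1 \<le> k \<Longrightarrow> k \<le> n \<Longrightarrow> cmod (root_coeff \<zeta> k) \<le> D * \<rho>"
    and w: "w ^ (n + 1) = 1"
  shows "Re (poly P w) \<ge> - (real n * D * (real (n + 1) * (1 + 2 * real n * D))) * \<rho>\<^sup>2"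
proof -
  let ?N = "n + 1"
  have \<rho>: "0 \<le> \<rho>" using \<beta> by linarith
  have nw: "cmod w = 1" by (rule unity_root_norm[OF w]) simp
  have split: "sum f {..n} = f 0 + sum f {1..n}" for f :: "nat \<Rightarrow> 'x::comm_monoid_add"
    by (metis One_nat_def atMost_atLeast0 sum.atLeast_Suc_atMost zero_le)
  let ?e = "\<Sum>k=1..n. root_coeff \<zeta> k * w ^ (?N - k)"
  have wP': "w * poly (pderiv P) w = of_nat ?N * (1 + ?e)"
  proof -
    have "w * poly (pderiv P) w = of_nat ?N * (w * poly (poly_of_roots \<zeta>) w)"
      by (simp add: P')
    also have "w * poly (poly_of_roots \<zeta>) w = 1 + ?e"
      unfolding poly_of_roots_rev_sum[OF P'(2)] split using w by simp
    finally show ?thesis .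
  qed
  have "cmod ?e \<le> (\<Sum>k=1..n. D * \<rho>)"
    by (rule sum_norm_le) (use D nw in \<open>auto simp: norm_mult norm_power\<close>)
  hence e: "cmod ?e \<le> real n * D * \<rho>" by simp
  have pb: "cmod (w ^ j - of_real \<beta> ^ j) \<le> 2" for j
  proof -
    have "cmod (of_real \<beta> ^ j) \<le> 1" using \<beta> by (simp add: norm_power power_le_one)
    thus ?thesis using norm_triangle_ineq4[of "w ^ j" "of_real \<beta> ^ j"] nw by (simp add: norm_power)
  qed
  have Pw: "poly P w = of_nat ?N *
           (\<Sum>k\<le>n. root_coeff \<zeta> k / of_nat (?N - k) * (w ^ (?N - k) - of_real \<beta> ^ (?N - k)))"
    using poly_via_critical_points[of P n \<zeta> w "of_real \<beta>"] P P' \<beta>(1) by simp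
  have "cmod (\<Sum>k\<le>n. root_coeff \<zeta> k / of_nat (?N - k) * (w ^ (?N - k) - of_real \<beta> ^ (?N - k)))
        \<le> (\<Sum>k\<le>n. if k = 0 then \<rho> else 2 * D * \<rho>)"
  proof (rule sum_norm_le)
    fix k assume "k \<in> {..n}"
    hence k: "k \<le> n" by simp
    show "cmod (root_coeff \<zeta> k / of_nat (?N - k) * (w ^ (?N - k) - of_real \<beta> ^ (?N - k)))
       \<le> (if k = 0 then \<rho> else 2 * D * \<rho>)"
    proof (cases "k = 0")
      case True
      have "1 - \<beta> ^ ?N \<le> real ?N * (1 - \<beta>)"
        using Bernoulli_inequality[of "\<beta> - 1" ?N] \<beta> by (simp add: algebra_simps)
      also have "\<dots> \<le> real ?N * \<rho>" using \<beta> by (intro mult_left_mono) auto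
      finally have "(1 - \<beta> ^ ?N) / real ?N \<le> \<rho>" by (simp add: field_simps)
      moreover have "cmod (w ^ ?N - of_real \<beta> ^ ?N) = 1 - \<beta> ^ ?N"
      proof -
        have "w ^ ?N - of_real \<beta> ^ ?N = of_real (1 - \<beta> ^ ?N)" using w by simp
        moreover have "\<beta> ^ ?N \<le> 1" using \<beta> by (intro power_le_one)
        ultimately show ?thesis by (simp only: norm_of_real)
      qed
      ultimately show ?thesis using True
        by (simp add: norm_mult norm_divide del: of_nat_Suc power_Suc of_nat_add)
    next
      case False
      have "cmod (root_coeff \<zeta> k) / real (?N - k) \<le> cmod (root_coeff \<zeta> k) / 1"
        using k by (intro divide_left_mono) auto
      also have "\<dots> \<le> D * \<rho>" using D(2)[of k] k False by simp
      finally have "cmod (root_coeff \<zeta> k) / real (?N - k) * cmod (w ^ (?N - k) - of_real \<beta> ^ (?N - k))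
          \<le> D * \<rho> * 2" using pb D \<rho> by (intro mult_mono) auto
      thus ?thesis using False by (simp add: norm_mult norm_divide mult_ac)
    qed
  qed
  also have "\<dots> = (1 + 2 * real n * D) * \<rho>"
    unfolding split by (simp add: algebra_simps)
  finally have "cmod (poly P w) \<le> real ?N * ((1 + 2 * real n * D) * \<rho>)"
    unfolding Pw norm_mult norm_of_nat by (intro mult_left_mono) auto
  with e have ePw: "cmod ?e * cmod (poly P w) \<le>
      (real n * D * \<rho>) * (real ?N * ((1 + 2 * real n * D) * \<rho>))"
    using D \<rho> by (intro mult_mono) auto
  have "0 \<le> Re (w * poly (pderiv P) w * cnj (poly P w))"
    unfolding P(1) by (rule Re_pderiv_poly_of_roots_nonneg[OF P(3) nw])
  also have "\<dots> = real ?N * (Re (poly P w) + Re (?e * cnj (poly P w)))"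
    unfolding wP' by (simp add: algebra_simps)
  finally have "0 \<le> Re (poly P w) + Re (?e * cnj (poly P w))"
    by (simp add: zero_le_mult_iff del: of_nat_Suc of_nat_add)
  moreover have "Re (?e * cnj (poly P w)) \<le> cmod ?e * cmod (poly P w)"
    using complex_Re_le_cmod[of "?e * cnj (poly P w)"] by (simp add: norm_mult)
  ultimately have "Re (poly P w) \<ge> - ((real n * D * \<rho>) * (real ?N * ((1 + 2 * real n * D) * \<rho>)))"
    using ePw by linarith
  thus ?thesis by (simp only: power2_eq_square minus_mult_left mult_ac)
qed

lemma Re_sum_list: "Re (sum_list zs) = (\<Sum>z\<leftarrow>zs. Re z)"
  by (induction zs) auto

lemma cnj_unity_root_power:
  assumes "w ^ (n + 1) = (1::complex)" "k \<le> n + 1"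
  shows "w ^ (n + 1 - k) = cnj w ^ k"
proof -
  have w: "w * cnj w = 1" using unity_root_norm[OF assms(1)] complex_norm_square[of w] by simp
  have "w ^ (n + 1 - k) = w ^ (n + 1 - k) * (w * cnj w) ^ k" by (simp add: w)
  also have "\<dots> = w ^ (n + 1) * cnj w ^ k"
    using assms(2) by (simp add: power_mult_distrib flip: power_add)
  finally show ?thesis using assms(1) by simp
qed

section \<open>The upper bound\<close>

text \<open>
  The disk condition is used twice, because its error is the square of the size \<open>\<rho>\<close> of the
  perturbation. A priori the sum of the critical points is only \<open>O(sqrt \<epsilon>)\<close>. With \<open>\<rho> = sqrt \<epsilon>\<close>, the
  conditions at \<open>w\<close> and \<open>cnj w\<close> for one nonreal \<open>w\<close> bound the imaginary part of this sum from both
  sides by \<open>O(\<epsilon>)\<close>. All coefficients are then \<open>O(\<epsilon>)\<close>, and with \<open>\<rho> = \<epsilon>\<close> the conditions hold up to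
  \<open>O(\<epsilon>\<^sup>2)\<close>.
\<close>
lemma crit_dist_upper_core:
  fixes n :: nat and M :: real
  assumes n: "n \<ge> 3" and M: "M \<ge> 1"
  obtains C where "C \<ge> 0"
    "\<And>\<beta> d zs \<zeta>. \<lbrakk>0 < \<beta>; \<beta> < 1; length zs = n + 1; of_real \<beta> \<in> set zs; \<And>z. z \<in> set zs \<Longrightarrow> cmod z \<le> 1;
       pderiv (poly_of_roots zs) = smult (of_nat (n + 1)) (poly_of_roots \<zeta>); length \<zeta> = n;
       \<And>x. x \<in> set \<zeta> \<Longrightarrow> \<bar>Re x\<bar> \<le> M * (1 - \<beta>);
       \<And>x. x \<in> set \<zeta> \<Longrightarrow> \<bar>Im x\<bar> \<le> M * sqrt (1 - \<beta>);
       \<And>x. x \<in> set \<zeta> \<Longrightarrow> d \<le> cmod (of_real \<beta> - x);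
       \<beta> \<le> d; d \<le> 1 + M * (1 - \<beta>)\<rbrakk> \<Longrightarrow>
       d \<le> 1 - sendov_slope n * (1 - \<beta>) + C * (1 - \<beta>)\<^sup>2"
proof -
  let ?N = "n + 1"
  \<comment> \<open>\<open>D1\<close>, \<open>D2\<close> bound the coefficients and \<open>E1\<close>, \<open>E2\<close> are the resulting errors of the disk condition
    for \<open>\<rho> = sqrt \<epsilon>\<close> and \<open>\<rho> = \<epsilon>\<close>; \<open>Y\<close> bounds the imaginary part of the sum of the critical points.\<close>
  define D where "D = (1 + 2 * M) ^ n"
  define \<theta> where "\<theta> = 2 * pi * real 1 / real ?N"
  define E where "E = real n * D * (real ?N * (1 + 2 * real n * D))"
  define D1 where "D1 = 2 * D"
  define E1 where "E1 = real n * D1 * (real ?N * (1 + 2 * real n * D1))"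
  define F where "F = E1 + 1 + 2 * D + 4 * real n * D"
  define Y where "Y = real n * F / sin \<theta>"
  define D2 where "D2 = 2 * D + Y"
  define E2 where "E2 = real n * D2 * (real ?N * (1 + 2 * real n * D2))"
  define C1 where "C1 = E2 + D + D + (Y\<^sup>2 + real n * M\<^sup>2) + 2 * real n * D"
  define C2 where "C2 = (M + 1)\<^sup>2"
  define C3 where "C3 = C1 + 2 * C2"
  obtain m where m: "m > 0" "\<And>w. w \<in> nontrivial_unity_roots ?N \<Longrightarrow> m \<le> 1 - Re w"
    using nontrivial_unity_roots_gap[of n] n by auto
  have D: "D \<ge> 1" unfolding D_def by (rule one_le_power) (use M in simp)
  have \<theta>: "0 < \<theta>" "\<theta> < pi"
    unfolding \<theta>_def using n by (auto simp: field_simps)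
  have s: "sin \<theta> > 0" by (rule sin_gt_zero) (use \<theta> in auto)
  have pos: "E1 \<ge> 0" "Y \<ge> 0" "E2 \<ge> 0" "C1 \<ge> 0" "C2 \<ge> 0" "C3 \<ge> 0"
  proof -
    show E1: "E1 \<ge> 0" unfolding E1_def D1_def using D by simp
    show Y: "Y \<ge> 0" unfolding Y_def F_def using D s E1 by simp
    show E2: "E2 \<ge> 0" unfolding E2_def D2_def using D Y by simp
    show C1: "C1 \<ge> 0" unfolding C1_def using D E2 by simp
    show C2: "C2 \<ge> 0" unfolding C2_def using M by simp
    show "C3 \<ge> 0" unfolding C3_def using C1 C2 by simp
  qed
  have main: "d \<le> 1 - sendov_slope n * (1 - \<beta>) + C3 / m * (1 - \<beta>)\<^sup>2"
    if \<beta>: "0 < \<beta>" "\<beta> < 1" and zs: "length zs = ?N" "of_real \<beta> \<in> set zs" "\<And>z. z \<in> set zs \<Longrightarrow> cmod z \<le> 1"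
      and \<zeta>: "pderiv (poly_of_roots zs) = smult (of_nat ?N) (poly_of_roots \<zeta>)" "length \<zeta> = n"
      and x: "\<And>x. x \<in> set \<zeta> \<Longrightarrow> \<bar>Re x\<bar> \<le> M * (1 - \<beta>)"
      and y: "\<And>x. x \<in> set \<zeta> \<Longrightarrow> \<bar>Im x\<bar> \<le> M * sqrt (1 - \<beta>)"
      and d: "\<And>x. x \<in> set \<zeta> \<Longrightarrow> d \<le> cmod (of_real \<beta> - x)" "\<beta> \<le> d" "d \<le> 1 + M * (1 - \<beta>)"
    for \<beta> d :: real and zs \<zeta> :: "complex list"
  proof -
    define \<epsilon> where "\<epsilon> = 1 - \<beta>"
    define \<eta> where "\<eta> = sqrt \<epsilon>"
    define c where "c k = root_coeff \<zeta> k" for k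
    define P where "P = poly_of_roots zs"
    define q where "q = (\<Sum>z\<leftarrow>\<zeta>. (Im z)\<^sup>2) / 2"
    have \<epsilon>: "0 < \<epsilon>" "\<epsilon> < 1" "1 - \<beta> = \<epsilon>" using \<beta> by (auto simp: \<epsilon>_def)
    have \<eta>2: "\<eta>\<^sup>2 = \<epsilon>" and \<eta>: "0 \<le> \<eta>" "\<eta> \<le> 1" using \<epsilon> by (auto simp: \<eta>_def)
    have \<epsilon>\<eta>: "\<epsilon> \<le> \<eta>" using \<eta> by (simp add: power2_eq_square mult_left_le flip: \<eta>2)
    have small: "\<bar>Re z\<bar> \<le> M * \<eta>\<^sup>2" "\<bar>Im z\<bar> \<le> M * \<eta>" if "z \<in> set \<zeta>" for z
      using x[OF that] y[OF that] by (simp_all add: \<eta>2 \<epsilon>(3)) (simp add: \<eta>_def)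
    have M0: "0 \<le> M" using M by simp
    have parity: "\<bar>Re (c k)\<bar> \<le> D * \<eta> ^ (if even k then k else k + 1)"
      "\<bar>Im (c k)\<bar> \<le> D * \<eta> ^ (if even k then k + 1 else k)" for k
      unfolding c_def D_def \<zeta>(2)[symmetric]
      by (rule root_coeff_parity_bounds[OF small M0 \<eta>]; assumption)+
    have pw: "\<eta> ^ a \<le> \<eta> ^ b" if "b \<le> a" for a b using \<eta> that by (rule power_decreasing[rotated 1])
    have parity': "\<bar>Re (c k)\<bar> \<le> D * \<eta> ^ a" if "a \<le> (if even k then k else k + 1)" for k a
      using parity(1)[of k] mult_left_mono[OF pw[OF that], of D] D by linarith
    have iparity': "\<bar>Im (c k)\<bar> \<le> D * \<eta> ^ a" if "a \<le> (if even k then k + 1 else k)" for k a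
      using parity(2)[of k] mult_left_mono[OF pw[OF that], of D] D by linarith
    have R2: "\<bar>Re (c k)\<bar> \<le> D * \<epsilon>" if "1 \<le> k" for k
    proof -
      have "2 \<le> (if even k then k else k + 1)" using that by (cases "k = 1") auto
      from parity'[OF this] show ?thesis by (simp only: \<eta>2)
    qed
    have R1: "\<bar>Re (c k)\<bar> \<le> D * \<eta>" if "1 \<le> k" for k
      using R2[OF that] mult_left_mono[OF \<epsilon>\<eta>, of D] D by linarith
    have I1: "\<bar>Im (c k)\<bar> \<le> D * \<eta>" if "1 \<le> k" for k
    proof -
      have "1 \<le> (if even k then k + 1 else k)" using that by simp
      from iparity'[OF this] show ?thesis by (simp only: power_one_right)
    qed
    have I2: "\<bar>Im (c k)\<bar> \<le> D * \<epsilon>" if "2 \<le> k" for k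
    proof -
      have "2 \<le> (if even k then k + 1 else k)" using that by simp
      from iparity'[OF this] show ?thesis by (simp only: \<eta>2)
    qed
    have P\<beta>: "poly P (of_real \<beta>) = 0" using zs(2) by (simp add: P_def poly_of_roots_eq_0_iff)
    have P': "pderiv P = smult (of_nat ?N) (poly_of_roots \<zeta>)" using \<zeta> by (simp add: P_def)
    have degP: "degree P = ?N" using zs by (simp add: P_def)
    have Pw: "poly P w = of_nat ?N * (\<Sum>k\<le>n. c k / of_nat (?N - k) * (w ^ (?N - k) - of_real \<beta> ^ (?N - k)))"
      for w
      using poly_via_critical_points[OF degP P' \<zeta>(2), of w "of_real \<beta>"] P\<beta> by (simp add: c_def)
    have RePw: "Re (poly P w) = real ?N * (\<Sum>k\<le>n. Re (c k * (w ^ (?N - k) - of_real (\<beta> ^ (?N - k)))) / real (?N - k))"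
      for w
    proof -
      have 1: "Re (poly P w) = real ?N * (\<Sum>k\<le>n. Re (c k / of_nat (?N - k) * (w ^ (?N - k) - of_real \<beta> ^ (?N - k))))"
        unfolding Pw by (simp only: Re_sum[symmetric]) (simp del: of_nat_Suc of_nat_add)
      have 2: "Re (c k / of_nat (?N - k) * (w ^ (?N - k) - of_real \<beta> ^ (?N - k))) =
          Re (c k * (w ^ (?N - k) - of_real (\<beta> ^ (?N - k)))) / real (?N - k)" for k
        by (simp only: times_divide_eq_left Re_divide_of_nat of_real_power)
      show ?thesis by (simp only: 1 2)
    qed
    have bern: "0 \<le> 1 - \<beta> ^ j" "1 - \<beta> ^ j \<le> real j * \<epsilon>" for j
      using Bernoulli_inequality[of "\<beta> - 1" j] \<beta> by (auto simp: \<epsilon>_def algebra_simps power_le_one)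
    have lower: "Re (poly P w) \<ge> - (real n * D' * (real ?N * (1 + 2 * real n * D'))) * \<rho>\<^sup>2"
      if "w ^ ?N = 1" "\<epsilon> \<le> \<rho>" "0 \<le> D'" "\<And>k. 1 \<le> k \<Longrightarrow> k \<le> n \<Longrightarrow> cmod (c k) \<le> D' * \<rho>" for w D' \<rho>
      by (rule Re_poly_at_unity_root_ge[of P zs n \<zeta> \<beta>])
         (use that zs P' \<zeta> P\<beta> \<beta> in \<open>auto simp: P_def \<epsilon>_def c_def\<close>)
    have split: "sum f {..n} = f 0 + (f 1 + (f 2 + sum f {3..n}))" for f :: "nat \<Rightarrow> real"
    proof -
      have "{..n} = insert 0 (insert 1 (insert 2 {3..n}))" using n by auto
      thus ?thesis by simp
    qed

    have scale: "- a \<le> X" if "- a \<le> real ?N * X" "0 \<le> a" for a X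
    proof (cases "X \<ge> 0")
      case False
      hence "real ?N * X \<le> 1 * X" by (intro mult_right_mono_neg) auto
      with that show ?thesis by linarith
    qed (use that in linarith)
    have diff2: "cmod (w ^ j - of_real (\<beta> ^ j)) \<le> 2" if "w ^ ?N = 1" for w j
    proof -
      have "cmod w = 1" by (rule unity_root_norm[OF that]) simp
      moreover have "cmod (of_real (\<beta> ^ j)) \<le> 1" using \<beta> by (simp add: norm_power power_le_one)
      ultimately show ?thesis
        using norm_triangle_ineq4[of "w ^ j" "of_real (\<beta> ^ j)"] by (simp add: norm_power)
    qed

    have Im1: "\<bar>Im (c 1)\<bar> \<le> Y * \<epsilon>"
    proof -
      have cb: "cmod (c k) \<le> D1 * \<eta>" if "1 \<le> k" for k
        using cmod_le[of "c k"] R1[OF that] I1[OF that] by (simp add: D1_def)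
      have bound: "0 \<le> F * \<epsilon> + Im (c 1) * Im w / real n"
        if w: "w ^ ?N = 1" for w
      proof -
        let ?f = "\<lambda>k. Re (c k * (w ^ (?N - k) - of_real (\<beta> ^ (?N - k)))) / real (?N - k)"
        have f0: "?f 0 \<le> \<epsilon>"
        proof -
          have "?f 0 = (1 - \<beta> ^ ?N) / real ?N" using w by (simp add: c_def)
          also have "\<dots> \<le> \<epsilon>" using bern(2)[of ?N] by (simp add: pos_divide_le_eq mult.commute)
          finally show ?thesis .
        qed
        have f1: "?f 1 \<le> 2 * D * \<epsilon> + Im (c 1) * Im w / real n"
        proof -
          have *: "w ^ (?N - 1) = cnj w" using cnj_unity_root_power[OF w, of 1] by simp
          have "\<bar>Re w - \<beta> ^ n\<bar> \<le> 2"
            using diff2[OF w, of n] abs_Re_le_cmod[of "w ^ n - of_real (\<beta> ^ n)"] * by simp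
          moreover have "\<bar>Re (c 1)\<bar> \<le> D * \<epsilon>" using R2 by simp
          ultimately have "\<bar>Re (c 1)\<bar> * \<bar>Re w - \<beta> ^ n\<bar> \<le> D * \<epsilon> * 2"
            by (intro mult_mono) (use D \<epsilon> in auto)
          hence 1: "Re (c 1) * (Re w - \<beta> ^ n) \<le> 2 * D * \<epsilon>"
            using abs_ge_self[of "Re (c 1) * (Re w - \<beta> ^ n)"] by (simp add: abs_mult)
          have "?f 1 = Re (c 1) * (Re w - \<beta> ^ n) / real n + Im (c 1) * Im w / real n"
            unfolding * by (simp add: algebra_simps add_divide_distrib diff_divide_distrib)
          also have "Re (c 1) * (Re w - \<beta> ^ n) / real n \<le> (2 * D * \<epsilon>) / real n"
            using 1 by (intro divide_right_mono) auto
          also have "\<dots> \<le> (2 * D * \<epsilon>) / 1" using n D \<epsilon> by (intro divide_left_mono) auto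
          finally show ?thesis by simp
        qed
        have fk: "?f k \<le> 4 * D * \<epsilon>" if "2 \<le> k" "k \<le> n" for k
        proof -
          have "cmod (c k) \<le> 2 * D * \<epsilon>"
            using cmod_le[of "c k"] R2[of k] I2[of k] that by simp
          hence "cmod (c k) * cmod (w ^ (?N - k) - of_real (\<beta> ^ (?N - k))) \<le> 2 * D * \<epsilon> * 2"
            by (intro mult_mono diff2[OF w]) (use D \<epsilon> in auto)
          hence "Re (c k * (w ^ (?N - k) - of_real (\<beta> ^ (?N - k)))) \<le> 4 * D * \<epsilon>"
            using complex_Re_le_cmod[of "c k * (w ^ (?N - k) - of_real (\<beta> ^ (?N - k)))"]
            unfolding norm_mult by linarith
          hence "?f k \<le> (4 * D * \<epsilon>) / real (?N - k)" by (intro divide_right_mono) auto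
          also have "\<dots> \<le> (4 * D * \<epsilon>) / 1" using that D \<epsilon> by (intro divide_left_mono) auto
          finally show ?thesis by simp
        qed
        have "sum ?f {3..n} \<le> real (card {3..n}) * (4 * D * \<epsilon>)"
          by (rule sum_bounded_above) (rule fk; simp)
        also have "real (card {3..n}) = real n - 2" using n by simp
        finally have "?f 2 + sum ?f {3..n} \<le> (real n - 1) * (4 * D * \<epsilon>)"
          using fk[of 2] n by (simp add: algebra_simps)
        also have "\<dots> \<le> real n * (4 * D * \<epsilon>)" using D \<epsilon> by (intro mult_right_mono) auto
        finally have "sum ?f {..n} \<le> (1 + 2 * D + 4 * real n * D) * \<epsilon> + Im (c 1) * Im w / real n"
          unfolding split using f0 f1 unfolding distrib_right by linarith
        moreover have "- (E1 * \<epsilon>) \<le> real ?N * sum ?f {..n}"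
          using lower[OF w \<epsilon>\<eta>, of D1] cb D \<eta>2 unfolding RePw by (auto simp: E1_def D1_def)
        hence "- (E1 * \<epsilon>) \<le> sum ?f {..n}" by (rule scale) (use pos \<epsilon> in simp)
        ultimately show ?thesis unfolding F_def distrib_right by linarith
      qed
      \<comment> \<open>The imaginary parts of \<open>w\<close> and \<open>cnj w\<close> have opposite signs, so the bounds are two-sided.\<close>
      have w: "cis \<theta> ^ ?N = 1"
        using cis_root_in[of 1 ?N] n by (auto simp: \<theta>_def nontrivial_unity_roots_def)
      hence w': "cnj (cis \<theta>) ^ ?N = 1" by (metis complex_cnj_one complex_cnj_power)
      have "\<bar>Im (c 1)\<bar> * sin \<theta> / real n \<le> F * \<epsilon>"
        using bound[OF w] bound[OF w'] by (cases "Im (c 1) \<ge> 0") auto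
      thus ?thesis using s n by (simp add: Y_def field_simps)
    qed

    define a where "a = (\<Sum>z\<leftarrow>\<zeta>. Re z)"
    define \<delta> where "\<delta> = \<beta> - d"
    have c1: "c 1 = - sum_list \<zeta>" unfolding c_def by (rule root_coeff_1)
    hence Re1: "Re (c 1) = - a" by (simp add: a_def Re_sum_list)
    have a: "\<bar>a\<bar> \<le> D * \<epsilon>" using R2[of 1] Re1 by simp
    \<comment> \<open>Newton's identity: up to \<open>O(\<epsilon>\<^sup>2)\<close> the second coefficient is the sum of the squared imaginary
      parts, halved.\<close>
    have Re2: "Re (c 2) \<ge> q - (Y\<^sup>2 + real n * M\<^sup>2) * \<epsilon>\<^sup>2 / 2"
    proof -
      have "2 * c 2 = (sum_list \<zeta>)\<^sup>2 - (\<Sum>z\<leftarrow>\<zeta>. z\<^sup>2)" unfolding c_def by (rule root_coeff_2)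
      hence "Re (2 * c 2) = Re ((sum_list \<zeta>)\<^sup>2 - (\<Sum>z\<leftarrow>\<zeta>. z\<^sup>2))" by (rule arg_cong)
      moreover have "Re (\<Sum>z\<leftarrow>xs. z\<^sup>2) = (\<Sum>z\<leftarrow>xs. (Re z)\<^sup>2) - (\<Sum>z\<leftarrow>xs. (Im z)\<^sup>2)" for xs
        by (induction xs) (auto simp: power2_eq_square)
      ultimately have e: "2 * Re (c 2) = (Re (c 1))\<^sup>2 - (Im (c 1))\<^sup>2 - (\<Sum>z\<leftarrow>\<zeta>. (Re z)\<^sup>2) + 2 * q"
        unfolding c1 by (simp add: q_def Re_power2)
      have "(Im (c 1))\<^sup>2 \<le> (Y * \<epsilon>)\<^sup>2" using Im1 by (metis abs_ge_zero power2_abs power_mono)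
      moreover have "(\<Sum>z\<leftarrow>\<zeta>. (Re z)\<^sup>2) \<le> (\<Sum>z\<leftarrow>\<zeta>. (M * \<epsilon>)\<^sup>2)"
      proof (rule sum_list_mono)
        fix z assume "z \<in> set \<zeta>"
        hence "\<bar>Re z\<bar> \<le> M * \<epsilon>" using x \<epsilon>(3) by auto
        thus "(Re z)\<^sup>2 \<le> (M * \<epsilon>)\<^sup>2" by (metis abs_ge_zero power2_abs power_mono)
      qed
      hence "(\<Sum>z\<leftarrow>\<zeta>. (Re z)\<^sup>2) \<le> real n * (M * \<epsilon>)\<^sup>2" using \<zeta>(2) by (simp add: sum_list_triv)
      ultimately have "2 * Re (c 2) \<ge> 2 * q - (Y * \<epsilon>)\<^sup>2 - real n * (M * \<epsilon>)\<^sup>2"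
        using e zero_le_power2[of "Re (c 1)"] by linarith
      hence "q - ((Y * \<epsilon>)\<^sup>2 + real n * (M * \<epsilon>)\<^sup>2) / 2 \<le> Re (c 2)"
        by (simp only: diff_le_eq le_divide_eq_numeral1 add_divide_distrib)
      thus ?thesis by (simp add: power_mult_distrib distrib_right mult.assoc)
    qed
    have \<delta>: "- ((M + 1) * \<epsilon>) \<le> \<delta>" "\<delta> \<le> 0" using d(2,3) by (simp_all add: \<delta>_def \<epsilon>_def algebra_simps)
    \<comment> \<open>The distance condition \<open>|\<beta> - \<zeta>| \<ge> d\<close>, summed over all critical points.\<close>
    have a_le: "a / real n \<le> \<delta> + q / real n + C2 * \<epsilon>\<^sup>2"
    proof -
      have "a \<le> (\<Sum>z\<leftarrow>\<zeta>. (\<delta> + C2 * \<epsilon>\<^sup>2) + (Im z)\<^sup>2 / 2)"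
        unfolding a_def
      proof (rule sum_list_mono)
        fix z assume z: "z \<in> set \<zeta>"
        have "d\<^sup>2 \<le> (cmod (of_real \<beta> - z))\<^sup>2" using d(1)[OF z] d(2) \<beta> by (intro power_mono) auto
        hence 1: "d\<^sup>2 \<le> (\<beta> - Re z)\<^sup>2 + (Im z)\<^sup>2" by (simp add: cmod_power2)
        have "\<bar>Re z\<bar> \<le> M * \<epsilon>" using x[OF z] \<epsilon>(3) by auto
        hence 2: "(Re z)\<^sup>2 \<le> (M * \<epsilon>)\<^sup>2" by (metis abs_ge_zero power2_abs power_mono)
        have 3: "\<epsilon> * Re z \<le> \<epsilon> * (M * \<epsilon>)"
          using \<open>\<bar>Re z\<bar> \<le> M * \<epsilon>\<close> \<epsilon> by (intro mult_left_mono) auto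
        have 4: "- (\<epsilon> * \<delta>) \<le> \<epsilon> * ((M + 1) * \<epsilon>)"
          using mult_left_mono[OF \<delta>(1), of \<epsilon>] \<epsilon> by simp
        have d\<delta>: "d = 1 - \<epsilon> - \<delta>" "\<beta> = 1 - \<epsilon>" by (auto simp: \<delta>_def \<epsilon>_def)
        have "2 * Re z \<le> 2 * \<delta> - 2 * (\<epsilon> * \<delta>) - \<delta>\<^sup>2 + (Re z)\<^sup>2 + (Im z)\<^sup>2 + 2 * (\<epsilon> * Re z)"
          using 1 unfolding d\<delta> by (simp add: power2_eq_square algebra_simps)
        also have "\<dots> \<le> 2 * \<delta> + 2 * (\<epsilon> * ((M + 1) * \<epsilon>)) + (M * \<epsilon>)\<^sup>2 + (Im z)\<^sup>2 + 2 * (\<epsilon> * (M * \<epsilon>))"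
          using 2 3 4 zero_le_power2[of \<delta>] by linarith
        also have "\<dots> = 2 * \<delta> + (Im z)\<^sup>2 + (M\<^sup>2 + 4 * M + 2) * \<epsilon>\<^sup>2"
          by (simp add: power2_eq_square algebra_simps)
        also have "(M\<^sup>2 + 4 * M + 2) * \<epsilon>\<^sup>2 \<le> (2 * C2) * \<epsilon>\<^sup>2"
          unfolding C2_def by (intro mult_right_mono) (auto simp: power2_eq_square algebra_simps)
        finally show "Re z \<le> (\<delta> + C2 * \<epsilon>\<^sup>2) + (Im z)\<^sup>2 / 2" by simp
      qed
      also have "\<dots> = real n * (\<delta> + C2 * \<epsilon>\<^sup>2) + q"
      proof -
        have "(\<Sum>z\<leftarrow>xs. B + (Im z)\<^sup>2 / 2) = real (length xs) * B + (\<Sum>z\<leftarrow>xs. (Im z)\<^sup>2) / 2" for xs B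
          by (induction xs) (auto simp: algebra_simps add_divide_distrib)
        thus ?thesis by (simp add: q_def \<zeta>(2))
      qed
      finally have "a / real n \<le> (real n * (\<delta> + C2 * \<epsilon>\<^sup>2) + q) / real n"
        by (intro divide_right_mono) auto
      also have "\<dots> = \<delta> + q / real n + C2 * \<epsilon>\<^sup>2" using n by (simp add: add_divide_distrib)
      finally show ?thesis .
    qed
    have cb: "cmod (c k) \<le> D2 * \<epsilon>" if "1 \<le> k" for k
    proof (cases "k = 1")
      case True
      have "cmod (c k) \<le> D * \<epsilon> + Y * \<epsilon>"
        using cmod_le[of "c k"] R2[of 1] Im1 True by simp
      also have "\<dots> \<le> D2 * \<epsilon>" using D \<epsilon> by (simp add: D2_def algebra_simps)
      finally show ?thesis .
    next
      case False
      have "cmod (c k) \<le> D * \<epsilon> + D * \<epsilon>"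
        using cmod_le[of "c k"] R2[of k] I2[of k] False that by simp
      also have "\<dots> \<le> D2 * \<epsilon>" using pos \<epsilon> by (simp add: D2_def algebra_simps)
      finally show ?thesis .
    qed
    have key: "\<epsilon> * root_constraint n (q / \<epsilon>) (Re w) \<le> \<delta> + C3 / m * \<epsilon>\<^sup>2"
      if w: "w \<in> nontrivial_unity_roots ?N" for w
    proof -
      have wN: "w ^ ?N = 1" and nw: "cmod w = 1" and w1: "Re w < 1" "- 1 \<le> Re w"
        using nontrivial_unity_rootsD[OF w] by auto
      have w'N: "cnj w ^ ?N = 1" using wN by (metis complex_cnj_one complex_cnj_power)
      define u where "u = Re w"
      let ?h = "\<lambda>k. Re (c k) * (Re (w ^ (?N - k)) - \<beta> ^ (?N - k)) / real (?N - k)"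
      have hk: "?h k \<le> 2 * D * \<epsilon>\<^sup>2" if "3 \<le> k" "k \<le> n" for k
      proof -
        have "\<bar>Re (c k)\<bar> \<le> D * \<eta> ^ 4" by (rule parity') (use that in \<open>auto elim!: evenE\<close>)
        also have "\<eta> ^ 4 = \<epsilon>\<^sup>2" by (simp flip: \<eta>2 power_mult)
        finally have 1: "\<bar>Re (c k)\<bar> \<le> D * \<epsilon>\<^sup>2" .
        have "\<bar>Re (w ^ (?N - k)) - \<beta> ^ (?N - k)\<bar> \<le> 2"
          using diff2[OF wN, of "?N - k"] abs_Re_le_cmod[of "w ^ (?N - k) - of_real (\<beta> ^ (?N - k))"]
          by simp
        with 1 have "\<bar>Re (c k)\<bar> * \<bar>Re (w ^ (?N - k)) - \<beta> ^ (?N - k)\<bar> \<le> D * \<epsilon>\<^sup>2 * 2"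
          by (intro mult_mono) (use D \<epsilon> in auto)
        hence "Re (c k) * (Re (w ^ (?N - k)) - \<beta> ^ (?N - k)) \<le> 2 * D * \<epsilon>\<^sup>2"
          using abs_ge_self[of "Re (c k) * (Re (w ^ (?N - k)) - \<beta> ^ (?N - k))"]
          unfolding abs_mult by linarith
        hence "?h k \<le> (2 * D * \<epsilon>\<^sup>2) / real (?N - k)" by (intro divide_right_mono) auto
        also have "\<dots> \<le> (2 * D * \<epsilon>\<^sup>2) / 1" using that D \<epsilon> by (intro divide_left_mono) auto
        finally show ?thesis by simp
      qed
      have "sum ?h {3..n} \<le> real (card {3..n}) * (2 * D * \<epsilon>\<^sup>2)"
        by (rule sum_bounded_above) (rule hk; simp)
      also have "\<dots> \<le> real n * (2 * D * \<epsilon>\<^sup>2)" using D \<epsilon> by (intro mult_right_mono) auto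
      finally have h3: "sum ?h {3..n} \<le> 2 * real n * D * \<epsilon>\<^sup>2" by simp
      have h0: "?h 0 \<le> \<epsilon>"
      proof -
        have "?h 0 = (1 - \<beta> ^ ?N) / real ?N" unfolding diff_zero wN by (simp add: c_def)
        also have "\<dots> \<le> \<epsilon>" using bern(2)[of ?N] by (simp add: pos_divide_le_eq mult.commute)
        finally show ?thesis .
      qed
      have small: "x * ((1 - \<beta> ^ j) / real j) \<le> D * \<epsilon>\<^sup>2" if "\<bar>x\<bar> \<le> D * \<epsilon>" "j > 0" for x j
      proof -
        have b: "0 \<le> (1 - \<beta> ^ j) / real j" "(1 - \<beta> ^ j) / real j \<le> \<epsilon>"
          using bern[of j] that by (auto simp: pos_divide_le_eq mult.commute)
        have "x * ((1 - \<beta> ^ j) / real j) \<le> \<bar>x\<bar> * ((1 - \<beta> ^ j) / real j)"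
          using b by (intro mult_right_mono) auto
        also have "\<dots> \<le> (D * \<epsilon>) * \<epsilon>" using b that D \<epsilon> by (intro mult_mono) auto
        finally show ?thesis by (simp add: power2_eq_square)
      qed
      have h1: "?h 1 \<le> (1 - u) * (a / real n) + D * \<epsilon>\<^sup>2"
      proof -
        have "w ^ (?N - 1) = cnj w" using cnj_unity_root_power[OF wN, of 1] by simp
        hence "?h 1 = (1 - u) * (a / real n) + (- a) * ((1 - \<beta> ^ n) / real n)"
          using Re1 by (simp add: u_def algebra_simps add_divide_distrib diff_divide_distrib)
        thus ?thesis using small[of "- a" n] a n by simp
      qed
      have h2: "?h 2 \<le> - (2 * (1 - u\<^sup>2) / (real n - 1)) * q + (Y\<^sup>2 + real n * M\<^sup>2) * \<epsilon>\<^sup>2 + D * \<epsilon>\<^sup>2"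
      proof -
        have halve: "- (2 * v / x) * (p - b / 2) = - (2 * v / x) * p + (v / x) * b" for v x p b :: real
          by (simp add: right_diff_distrib)
        have "(Re w)\<^sup>2 + (Im w)\<^sup>2 = 1" using nw cmod_power2[of w] by simp
        hence "Re (cnj w ^ 2) = 2 * u\<^sup>2 - 1" by (simp add: u_def power2_eq_square)
        hence "Re (w ^ (?N - 2)) = 2 * u\<^sup>2 - 1" using cnj_unity_root_power[OF wN, of 2] n by simp
        moreover have "real (?N - 2) = real n - 1" using n by simp
        ultimately have "?h 2 = Re (c 2) * (2 * u\<^sup>2 - 1 - \<beta> ^ (?N - 2)) / (real n - 1)"
          by (simp only:)
        also have "\<dots> = - (2 * (1 - u\<^sup>2) / (real n - 1)) * Re (c 2) + Re (c 2) * ((1 - \<beta> ^ (?N - 2)) / (real n - 1))"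
          by (simp add: divide_inverse algebra_simps)
        also have "Re (c 2) * ((1 - \<beta> ^ (?N - 2)) / (real n - 1)) \<le> D * \<epsilon>\<^sup>2"
          using small[of "Re (c 2)" "?N - 2"] R2[of 2] n \<open>real (?N - 2) = real n - 1\<close> by simp
        also have "- (2 * (1 - u\<^sup>2) / (real n - 1)) * Re (c 2) \<le>
            - (2 * (1 - u\<^sup>2) / (real n - 1)) * (q - (Y\<^sup>2 + real n * M\<^sup>2) * \<epsilon>\<^sup>2 / 2)"
        proof -
          have "u\<^sup>2 \<le> 1" using w1 by (simp add: u_def abs_square_le_1)
          hence "0 \<le> 2 * (1 - u\<^sup>2) / (real n - 1)" using n by simp
          from mult_left_mono[OF Re2 this] show ?thesis by simp
        qed
        also have "- (2 * (1 - u\<^sup>2) / (real n - 1)) * (q - (Y\<^sup>2 + real n * M\<^sup>2) * \<epsilon>\<^sup>2 / 2) =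
            - (2 * (1 - u\<^sup>2) / (real n - 1)) * q + ((1 - u\<^sup>2) / (real n - 1)) * ((Y\<^sup>2 + real n * M\<^sup>2) * \<epsilon>\<^sup>2)"
          by (rule halve)
        also have "((1 - u\<^sup>2) / (real n - 1)) * ((Y\<^sup>2 + real n * M\<^sup>2) * \<epsilon>\<^sup>2) \<le>
            1 * ((Y\<^sup>2 + real n * M\<^sup>2) * \<epsilon>\<^sup>2)"
        proof (rule mult_right_mono)
          have "1 - u\<^sup>2 \<le> real n - 1" using n zero_le_power2[of u] by linarith
          thus "(1 - u\<^sup>2) / (real n - 1) \<le> 1" using n by (simp add: pos_divide_le_eq)
        qed simp
        finally show ?thesis by simp
      qed
      \<comment> \<open>Adding the two conjugate conditions leaves only the real parts of the coefficients.\<close>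
      have "Re (poly P w) + Re (poly P (cnj w)) = real ?N * (2 * sum ?h {..n})"
      proof -
        have "Re (c k * (w ^ j - of_real b)) / x + Re (c k * (cnj w ^ j - of_real b)) / x =
            2 * (Re (c k) * (Re (w ^ j) - b) / x)" for k j b x
          by (simp flip: complex_cnj_power add: algebra_simps add_divide_distrib diff_divide_distrib)
        thus ?thesis
          unfolding RePw by (simp only: distrib_left[symmetric] sum.distrib[symmetric] sum_distrib_left[symmetric])
      qed
      moreover have "- (E2 * \<epsilon>\<^sup>2) \<le> Re (poly P w)" "- (E2 * \<epsilon>\<^sup>2) \<le> Re (poly P (cnj w))"
        using lower[OF wN order_refl, of D2] lower[OF w'N order_refl, of D2] cb D pos
        by (auto simp: E2_def D2_def)
      ultimately have "- (E2 * \<epsilon>\<^sup>2) \<le> real ?N * sum ?h {..n}" by simp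
      hence "- (E2 * \<epsilon>\<^sup>2) \<le> sum ?h {..n}" by (rule scale) (use pos in simp)
      hence 1: "0 \<le> \<epsilon> + (1 - u) * (a / real n) - (2 * (1 - u\<^sup>2) / (real n - 1)) * q + C1 * \<epsilon>\<^sup>2"
        unfolding split C1_def using h0 h1 h2 h3 unfolding distrib_right by linarith
      have u: "0 < 1 - u" "1 - u \<le> 2" using w1 by (auto simp: u_def)
      have "(1 - u) * (a / real n) \<le> (1 - u) * (\<delta> + q / real n + C2 * \<epsilon>\<^sup>2)"
        using a_le u by (intro mult_left_mono) auto
      also have "\<dots> = (1 - u) * (\<delta> + q / real n) + (1 - u) * (C2 * \<epsilon>\<^sup>2)" by (simp only: distrib_left)
      also have "(1 - u) * (C2 * \<epsilon>\<^sup>2) \<le> 2 * (C2 * \<epsilon>\<^sup>2)"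
        using u pos by (intro mult_right_mono) auto
      finally have 2: "0 \<le> \<epsilon> + (1 - u) * (\<delta> + q / real n) - (2 * (1 - u\<^sup>2) / (real n - 1)) * q + C3 * \<epsilon>\<^sup>2"
        using 1 unfolding C3_def by (simp add: distrib_right)
      have "(1 - u) * (\<delta> - \<epsilon> * root_constraint n (q / \<epsilon>) u) =
          \<epsilon> + (1 - u) * (\<delta> + q / real n) - (2 * (1 - u\<^sup>2) / (real n - 1)) * q"
      proof -
        have "\<epsilon> * (q / \<epsilon> * X - Z) = q * X - \<epsilon> * Z" for X Z
          using \<epsilon> by (simp add: right_diff_distrib)
        hence "\<epsilon> * root_constraint n (q / \<epsilon>) u =
            q * (2 * (1 + u) / (real n - 1) - 1 / real n) - \<epsilon> * (1 / (1 - u))"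
          by (simp only: root_constraint_def)
        moreover have "(1 - u) * (\<epsilon> * (1 / (1 - u))) = \<epsilon>" using u by simp
        ultimately have "(1 - u) * (\<delta> - \<epsilon> * root_constraint n (q / \<epsilon>) u) =
          (1 - u) * (\<delta> - q * (2 * (1 + u) / (real n - 1) - 1 / real n)) + \<epsilon>"
          by (simp only: right_diff_distrib)
        thus ?thesis by (simp add: divide_inverse power2_eq_square algebra_simps)
      qed
      with 2 have "- (C3 * \<epsilon>\<^sup>2) \<le> (1 - u) * (\<delta> - \<epsilon> * root_constraint n (q / \<epsilon>) u)" by linarith
      hence "- (C3 * \<epsilon>\<^sup>2) / (1 - u) \<le> \<delta> - \<epsilon> * root_constraint n (q / \<epsilon>) u"
        by (subst pos_divide_le_eq[OF u(1)]) (simp only: mult.commute)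
      moreover have "(C3 * \<epsilon>\<^sup>2) / (1 - u) \<le> (C3 * \<epsilon>\<^sup>2) / m"
        using m(1) m(2)[OF w] pos by (intro frac_le) (auto simp: u_def)
      ultimately show ?thesis by (simp add: u_def)
    qed
    have "max_constraint n (q / \<epsilon>) \<le> (\<delta> + C3 / m * \<epsilon>\<^sup>2) / \<epsilon>"
      using n key \<epsilon> by (subst max_constraint_le_iff) (auto simp: pos_le_divide_eq mult.commute)
    moreover have "sendov_slope n \<le> 1 + max_constraint n (q / \<epsilon>)"
      by (rule sendov_slope_le) (use n \<epsilon> in \<open>auto simp: q_def intro!: divide_nonneg_pos sum_list_nonneg\<close>)
    ultimately have "sendov_slope n - 1 \<le> (\<delta> + C3 / m * \<epsilon>\<^sup>2) / \<epsilon>" by linarith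
    hence "(sendov_slope n - 1) * \<epsilon> \<le> \<delta> + C3 / m * \<epsilon>\<^sup>2" using \<epsilon> by (simp add: pos_le_divide_eq)
    moreover have "d = 1 - \<epsilon> - \<delta>" by (simp add: \<delta>_def \<epsilon>_def)
    ultimately show ?thesis unfolding \<epsilon>(3) by (simp add: algebra_simps)
  qed
  show ?thesis
  proof (rule that[of "C3 / m"])
    show "C3 / m \<ge> 0" using pos m by simp
  qed (rule main; assumption)
qed

lemma poly_of_roots_mset_cong: "mset xs = mset ys \<Longrightarrow> poly_of_roots xs = poly_of_roots ys"
  unfolding poly_of_roots_def by (metis mset_map prod_mset_prod_list)

lemma S_polys_monic_factorization:
  assumes P: "P \<in> S_polys (n + 1) \<beta>"
  obtains zs \<zeta> where "length zs = n" "\<And>z. z \<in> set zs \<Longrightarrow> cmod z \<le> 1" "length \<zeta> = n"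
    "pderiv (poly_of_roots (of_real \<beta> # zs)) = smult (of_nat (n + 1)) (poly_of_roots \<zeta>)"
    "\<And>x. x \<in> set \<zeta> \<Longrightarrow> crit_dist \<beta> P \<le> cmod (of_real \<beta> - x)"
proof -
  have deg: "degree P = n + 1" and roots: "\<And>z. poly P z = 0 \<Longrightarrow> cmod z \<le> 1"
    and \<beta>: "poly P (of_real \<beta>) = 0" using P by (auto simp: S_polys_def)
  have P0: "P \<noteq> 0" using deg by auto
  obtain xs where xs: "length xs = degree P" "P = smult (lead_coeff P) (poly_of_roots xs)"
    using ex_poly_of_roots[OF P0] .
  have root_iff: "poly P z = 0 \<longleftrightarrow> z \<in> set xs" for z
    using P0 by (subst xs(2)) (simp add: poly_of_roots_eq_0_iff)
  have "of_real \<beta> \<in> set xs" using \<beta> root_iff by simp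
  then obtain us vs where uv: "xs = us @ of_real \<beta> # vs" using split_list by metis
  define zs where "zs = us @ vs"
  have zs: "length zs = n" "set zs \<subseteq> set xs" using uv xs(1) deg by (auto simp: zs_def)
  have PP: "P = smult (lead_coeff P) (poly_of_roots (of_real \<beta> # zs))"
    using xs(2) poly_of_roots_mset_cong[of xs "of_real \<beta> # zs"] by (simp add: uv zs_def)
  define Q where "Q = pderiv (poly_of_roots (of_real \<beta> # zs))"
  have degQ: "degree Q = n" using zs by (simp add: Q_def degree_pderiv)
  have lcQ: "lead_coeff Q = of_nat (n + 1)"
    using poly_of_roots_monic[of "of_real \<beta> # zs"] zs unfolding degQ
    by (simp add: Q_def coeff_pderiv del: of_nat_Suc)
  hence "Q \<noteq> 0" by (metis leading_coeff_0_iff of_nat_eq_0_iff add_eq_0_iff_both_eq_0 one_neq_zero)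
  then obtain \<zeta> where \<zeta>: "length \<zeta> = degree Q" "Q = smult (lead_coeff Q) (poly_of_roots \<zeta>)"
    using ex_poly_of_roots by metis
  show ?thesis
  proof (rule that[of zs \<zeta>])
    show "pderiv (poly_of_roots (of_real \<beta> # zs)) = smult (of_nat (n + 1)) (poly_of_roots \<zeta>)"
      using \<zeta>(2) unfolding lcQ by (simp only: Q_def)
    fix x assume x: "x \<in> set \<zeta>"
    have "poly Q x = 0" by (subst \<zeta>(2)) (use x in \<open>simp add: poly_of_roots_eq_0_iff\<close>)
    hence "poly (pderiv P) x = 0" by (subst PP) (simp add: pderiv_smult flip: Q_def)
    hence "crit_dist \<beta> P \<le> dist (of_real \<beta>) x" unfolding crit_dist_def by (intro infdist_le) simp
    thus "crit_dist \<beta> P \<le> cmod (of_real \<beta> - x)" by (simp add: dist_norm)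
  qed (use zs \<zeta> degQ root_iff roots in auto)
qed

text \<open>
  Only polynomials whose critical distance exceeds \<open>1 - sendov_slope n * (1 - \<beta>)\<close> matter. Since the
  slope is less than 1, their critical distance is at least \<open>\<beta>\<close>, and this is the hypothesis under
  which the critical points are known to be small.
\<close>
lemma crit_dist_upper_bound:
  assumes n: "n \<ge> 3"
  obtains C \<beta>\<^sub>0 :: real where "0 \<le> C" "0 \<le> \<beta>\<^sub>0" "\<beta>\<^sub>0 < 1"
    "\<And>\<beta> P. \<lbrakk>\<beta>\<^sub>0 < \<beta>; \<beta> < 1; P \<in> S_polys (n + 1) \<beta>\<rbrakk> \<Longrightarrow>
       crit_dist \<beta> P \<le> 1 - sendov_slope n * (1 - \<beta>) + C * (1 - \<beta>)\<^sup>2"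
proof -
  have n1: "n \<ge> 1" using n by simp
  obtain M \<epsilon>\<^sub>0 where M: "M \<ge> 1" and \<epsilon>\<^sub>0: "0 < \<epsilon>\<^sub>0" "\<epsilon>\<^sub>0 \<le> 1 / 2" and
    near: "\<And>\<beta> zs \<zeta> x. \<lbrakk>1 - \<epsilon>\<^sub>0 < \<beta>; \<beta> < 1; length zs = n; \<And>z. z \<in> set zs \<Longrightarrow> cmod z \<le> 1;
       length \<zeta> = n;
       pderiv (poly_of_roots (of_real \<beta> # zs)) = smult (of_nat (n + 1)) (poly_of_roots \<zeta>);
       \<And>x. x \<in> set \<zeta> \<Longrightarrow> \<beta> \<le> cmod (of_real \<beta> - x); x \<in> set \<zeta>\<rbrakk> \<Longrightarrow>
       \<bar>Re x\<bar> \<le> M * (1 - \<beta>) \<and> \<bar>Im x\<bar> \<le> M * sqrt (1 - \<beta>) \<and> cmod (of_real \<beta> - x) \<le> 1 + M * (1 - \<beta>)"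
    using critical_points_near_zero[OF n1] by blast
  obtain C where C: "C \<ge> 0" and core:
    "\<And>\<beta> d zs \<zeta>. \<lbrakk>0 < \<beta>; \<beta> < 1; length zs = n + 1; of_real \<beta> \<in> set zs; \<And>z. z \<in> set zs \<Longrightarrow> cmod z \<le> 1;
       pderiv (poly_of_roots zs) = smult (of_nat (n + 1)) (poly_of_roots \<zeta>); length \<zeta> = n;
       \<And>x. x \<in> set \<zeta> \<Longrightarrow> \<bar>Re x\<bar> \<le> M * (1 - \<beta>);
       \<And>x. x \<in> set \<zeta> \<Longrightarrow> \<bar>Im x\<bar> \<le> M * sqrt (1 - \<beta>);
       \<And>x. x \<in> set \<zeta> \<Longrightarrow> d \<le> cmod (of_real \<beta> - x);
       \<beta> \<le> d; d \<le> 1 + M * (1 - \<beta>)\<rbrakk> \<Longrightarrow>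
       d \<le> 1 - sendov_slope n * (1 - \<beta>) + C * (1 - \<beta>)\<^sup>2"
    using crit_dist_upper_core[OF n M] by blast
  show ?thesis
  proof (rule that[of C "1 - \<epsilon>\<^sub>0"])
    fix \<beta> P assume \<beta>: "1 - \<epsilon>\<^sub>0 < \<beta>" "\<beta> < 1" and P: "P \<in> S_polys (n + 1) \<beta>"
    define d where "d = crit_dist \<beta> P"
    have \<beta>1: "0 < \<beta>" "cmod (of_real \<beta>) \<le> 1" using \<beta> \<epsilon>\<^sub>0 by auto
    show "crit_dist \<beta> P \<le> 1 - sendov_slope n * (1 - \<beta>) + C * (1 - \<beta>)\<^sup>2"
    proof (cases "d \<le> 1 - sendov_slope n * (1 - \<beta>)")
      case True
      thus ?thesis using C by (simp add: d_def add_increasing2)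
    next
      case False
      have "sendov_slope n * (1 - \<beta>) \<le> 1 * (1 - \<beta>)"
        using sendov_slope_less_1[of n] n \<beta> by (intro mult_right_mono) auto
      with False have d\<beta>: "\<beta> \<le> d" by simp
      obtain zs \<zeta> where f: "length zs = n" "\<And>z. z \<in> set zs \<Longrightarrow> cmod z \<le> 1" "length \<zeta> = n"
        "pderiv (poly_of_roots (of_real \<beta> # zs)) = smult (of_nat (n + 1)) (poly_of_roots \<zeta>)"
        "\<And>x. x \<in> set \<zeta> \<Longrightarrow> d \<le> cmod (of_real \<beta> - x)"
        using S_polys_monic_factorization[OF P] unfolding d_def by blast
      have "\<beta> \<le> cmod (of_real \<beta> - x)" if "x \<in> set \<zeta>" for x using f(5)[OF that] d\<beta> by linarith
      note nr = near[OF \<beta> f(1,2,3,4) this]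
      have "hd \<zeta> \<in> set \<zeta>" using f(3) n by (intro hd_in_set) auto
      hence "d \<le> 1 + M * (1 - \<beta>)" using f(5)[of "hd \<zeta>"] nr[of "hd \<zeta>"] by linarith
      hence "d \<le> 1 - sendov_slope n * (1 - \<beta>) + C * (1 - \<beta>)\<^sup>2"
        by (intro core[of \<beta> "of_real \<beta> # zs" \<zeta>]) (use f nr \<beta> \<beta>1 d\<beta> in auto)
      thus ?thesis by (simp add: d_def)
    qed
  qed (use C \<epsilon>\<^sub>0 in auto)
qed

section \<open>A family of nearly extremal polynomials\<close>

text \<open>
  The polynomial \<open>v ^ (n + 1) - 1 - g (n + 1) perturbation n v\<close> vanishes at \<open>1\<close> and has the derivative
  \<open>(n + 1) v ^ (n - 2) (v\<^sup>2 - g v + g)\<close>.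
\<close>
definition perturbation :: "nat \<Rightarrow> complex \<Rightarrow> complex" where
  "perturbation n v = (v ^ n - 1) / of_nat n - (v ^ (n - 1) - 1) / of_nat (n - 1)"

text \<open>
  Dividing \<open>v\<close> by the principal \<open>N\<close>-th root of \<open>1 + x\<close> gives the nearby root of unity.
\<close>
lemma near_unity_root:
  fixes v x :: complex
  assumes "N \<ge> 1" "v ^ N = 1 + x" "cmod x \<le> 1 / 4"
  obtains w where "w ^ N = 1" "cmod (v - w) \<le> 3 * cmod x"
proof -
  define h where "h = Ln (1 + x) / of_nat N"
  have "1 + x \<noteq> 0"
  proof
    assume "1 + x = 0"
    hence "x = -1" by (simp add: add_eq_0_iff)
    with assms(3) show False by simp
  qed
  hence e: "exp h ^ N = 1 + x" using assms(1) by (simp add: h_def flip: exp_of_nat_mult)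
  have "cmod h = cmod (Ln (1 + x)) / real N" by (simp add: h_def norm_divide)
  also have "\<dots> \<le> cmod (Ln (1 + x)) / 1" using assms(1) by (intro divide_left_mono) auto
  also have "\<dots> \<le> 2 * cmod x" using norm_Ln_le[of x] assms(3) by simp
  finally have h: "cmod h \<le> 2 * cmod x" .
  define w where "w = v / exp h"
  have w: "w ^ N = 1" using e assms(2) \<open>1 + x \<noteq> 0\<close> by (simp add: w_def power_divide)
  have "v - w = w * (exp h - 1)" by (simp add: w_def field_simps)
  hence "cmod (v - w) = cmod (exp h - 1)" using unity_root_norm[OF w] assms(1) by (simp add: norm_mult)
  also have "\<dots> \<le> 3 / 2 * cmod h" by (rule norm_exp_bounds(2)) (use h assms(3) in simp)
  finally show ?thesis using h w by (intro that[of w]) auto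
qed

lemma norm_power_diff_le:
  fixes v w :: complex
  assumes "cmod v \<le> 2" "cmod w \<le> 2"
  shows "cmod (v ^ m - w ^ m) \<le> real m * 2 ^ m * cmod (v - w)"
proof (induction m)
  case (Suc m)
  have "v ^ Suc m - w ^ Suc m = v * (v ^ m - w ^ m) + (v - w) * w ^ m" by (simp add: algebra_simps)
  hence "cmod (v ^ Suc m - w ^ Suc m) \<le> cmod v * cmod (v ^ m - w ^ m) + cmod (v - w) * cmod w ^ m"
    by (metis norm_mult norm_power norm_triangle_ineq)
  also have "\<dots> \<le> 2 * (real m * 2 ^ m * cmod (v - w)) + cmod (v - w) * 2 ^ m"
    using assms Suc by (intro add_mono mult_mono power_mono) auto
  also have "\<dots> = (2 * real m + 1) * (2 ^ m * cmod (v - w))" by (simp add: algebra_simps)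
  also have "\<dots> \<le> (2 * real m + 2) * (2 ^ m * cmod (v - w))" by (intro mult_right_mono) auto
  finally show ?case by (simp add: algebra_simps)
qed simp

lemma perturbation_lipschitz:
  assumes "n \<ge> 2" "cmod v \<le> 2" "cmod w \<le> 2"
  shows "cmod (perturbation n v - perturbation n w) \<le> 2 * 2 ^ n * cmod (v - w)"
proof -
  have quot: "cmod ((v ^ m - w ^ m) / of_nat m) \<le> 2 ^ n * cmod (v - w)" if "m \<ge> 1" "m \<le> n" for m
  proof -
    have "cmod ((v ^ m - w ^ m) / of_nat m) \<le> (real m * 2 ^ m * cmod (v - w)) / real m"
      unfolding norm_divide norm_of_nat
      using norm_power_diff_le[OF assms(2,3), of m] by (intro divide_right_mono) auto
    also have "\<dots> = 2 ^ m * cmod (v - w)" using that by simp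
    also have "\<dots> \<le> 2 ^ n * cmod (v - w)" using that by (intro mult_right_mono power_increasing) auto
    finally show ?thesis .
  qed
  have "perturbation n v - perturbation n w =
      (v ^ n - w ^ n) / of_nat n - (v ^ (n - 1) - w ^ (n - 1)) / of_nat (n - 1)"
    by (simp add: perturbation_def diff_divide_distrib)
  also have "cmod \<dots> \<le> 2 ^ n * cmod (v - w) + 2 ^ n * cmod (v - w)"
    by (rule order_trans[OF norm_triangle_ineq4 add_mono[OF quot quot]]) (use assms(1) in auto)
  finally show ?thesis by (simp add: mult_ac)
qed

lemma norm_perturbation_le:
  assumes "n \<ge> 2" "1 \<le> b" "cmod v \<le> b"
  shows "cmod (perturbation n v) \<le> 4 * b ^ n"
proof -
  have quot: "cmod ((v ^ m - 1) / of_nat m) \<le> 2 * b ^ n" if "m \<ge> 1" "m \<le> n" for m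
  proof -
    have "cmod (v ^ m - 1) \<le> cmod v ^ m + 1" using norm_triangle_ineq4[of "v ^ m" 1] by (simp add: norm_power)
    also have "cmod v ^ m \<le> b ^ m" using assms by (intro power_mono) auto
    also have "\<dots> \<le> b ^ n" using assms that by (intro power_increasing) auto
    finally have *: "cmod (v ^ m - 1) \<le> b ^ n + 1" by simp
    have "1 \<le> b ^ n" using assms by (intro one_le_power)
    with * have **: "cmod (v ^ m - 1) \<le> 2 * b ^ n" by simp
    have "cmod ((v ^ m - 1) / of_nat m) \<le> cmod (v ^ m - 1) / 1"
      unfolding norm_divide norm_of_nat using that by (intro divide_left_mono) auto
    with ** show ?thesis by simp
  qed
  have "cmod (perturbation n v) \<le> cmod ((v ^ n - 1) / of_nat n) + cmod ((v ^ (n - 1) - 1) / of_nat (n - 1))"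
    unfolding perturbation_def by (rule norm_triangle_ineq4)
  also have "\<dots> \<le> 2 * b ^ n + 2 * b ^ n" using assms by (intro add_mono quot) auto
  finally show ?thesis by simp
qed

text \<open>
  Every root \<open>v\<close> is within \<open>O(g)\<close> of some root of unity \<open>w\<close>, so \<open>v ^ (n + 1)\<close> is
  \<open>1 + g (n + 1) perturbation n w + O(g\<^sup>2)\<close>, and Bernoulli's inequality turns the resulting bound for
  \<open>|v| ^ (2 (n + 1))\<close> into one for \<open>|v|\<^sup>2\<close>. If \<open>w = 1\<close>, the perturbation at \<open>v\<close> is itself
  \<open>O(|v - 1|)\<close>, so that \<open>|v - 1| = O(g |v - 1|)\<close> and hence \<open>v = 1\<close>.
\<close>
lemma perturbed_unity_roots:
  assumes n: "n \<ge> 3"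
  obtains C g\<^sub>0 :: real where "C \<ge> 0" "0 < g\<^sub>0" "g\<^sub>0 \<le> 1"
    "\<And>g v. \<lbrakk>0 \<le> g; g \<le> g\<^sub>0; v ^ (n + 1) = 1 + of_real (g * real (n + 1)) * perturbation n v\<rbrakk> \<Longrightarrow>
       v = 1 \<or> (\<exists>w\<in>nontrivial_unity_roots (n + 1). cmod (v - w) \<le> C * g \<and>
         (cmod v)\<^sup>2 \<le> 1 + 2 * g * Re (perturbation n w) + C * g\<^sup>2)"
proof -
  let ?N = "real (n + 1)"
  define B :: real where "B = 4 * 2 ^ n"
  define L :: real where "L = 2 * 2 ^ n"
  define C' where "C' = ?N * L * (3 * ?N * B)"
  define C where "C = 3 * ?N * B + (2 * C' + (?N * B)\<^sup>2)"
  define g\<^sub>0 where "g\<^sub>0 = 1 / (8 * ?N * B)"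
  have BL: "B \<ge> 4" "L \<ge> 2" "L \<le> B" "?N \<ge> 1" by (simp_all add: B_def L_def)
  have NB: "?N * B \<ge> 4" using mult_mono[of 1 ?N 4 B] BL by simp
  have g\<^sub>0: "0 < g\<^sub>0" "g\<^sub>0 \<le> 1" "g\<^sub>0 * (?N * B) = 1 / 8"
    using NB BL by (auto simp: g\<^sub>0_def field_simps)
  have C': "C' \<ge> 0" unfolding C'_def using BL by simp
  have C: "C \<ge> 0" unfolding C_def using C' BL by simp
  have main: "v = 1 \<or> (\<exists>w\<in>nontrivial_unity_roots (n + 1). cmod (v - w) \<le> C * g \<and>
         (cmod v)\<^sup>2 \<le> 1 + 2 * g * Re (perturbation n w) + C * g\<^sup>2)"
    if g: "0 \<le> g" "g \<le> g\<^sub>0" and v: "v ^ (n + 1) = 1 + of_real (g * ?N) * perturbation n v" for g v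
  proof -
    define x where "x = of_real (g * ?N) * perturbation n v"
    have nx: "cmod x = g * ?N * cmod (perturbation n v)"
      using g by (simp add: x_def norm_mult del: of_nat_Suc of_nat_add)
    have "g * (?N * B) \<le> g\<^sub>0 * (?N * B)" using g NB by (intro mult_right_mono) auto
    hence gNB: "g * (?N * B) \<le> 1 / 8" by (simp only: g\<^sub>0(3))
    have gN: "g * ?N * 4 \<le> 1"
    proof -
      have "g * ?N * 4 \<le> g * ?N * B" using g BL by (intro mult_left_mono) auto
      thus ?thesis using gNB by (simp add: mult.assoc)
    qed
    have v2: "cmod v \<le> 2"
    proof (rule ccontr)
      assume "\<not> cmod v \<le> 2"
      hence v2: "cmod v > 2" by simp
      hence vn: "cmod v ^ n \<ge> 1" by (intro one_le_power) auto
      have "cmod (perturbation n v) \<le> 4 * cmod v ^ n"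
        by (rule norm_perturbation_le) (use n v2 in auto)
      hence "cmod x \<le> g * ?N * (4 * cmod v ^ n)" unfolding nx using g by (intro mult_left_mono) auto
      also have "\<dots> = (g * ?N * 4) * cmod v ^ n" by simp
      also have "\<dots> \<le> 1 * cmod v ^ n" using gN vn by (intro mult_right_mono) auto
      finally have "cmod x \<le> cmod v ^ n" by simp
      moreover have "cmod (v ^ (n + 1)) \<le> 1 + cmod x"
        unfolding v x_def[symmetric] using norm_triangle_ineq[of 1 x] by simp
      hence "cmod v * cmod v ^ n \<le> 1 + cmod x" by (simp add: norm_power norm_mult)
      moreover have "2 * cmod v ^ n < cmod v * cmod v ^ n" using v2 vn by (intro mult_strict_right_mono) linarith+
      ultimately show False using vn by linarith
    qed
    have "cmod (perturbation n v) \<le> B" unfolding B_def by (rule norm_perturbation_le) (use n v2 in auto)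
    hence x: "cmod x \<le> g * (?N * B)" unfolding nx mult.assoc using g by (intro mult_left_mono) auto
    have "v ^ (n + 1) = 1 + x" using v by (simp only: x_def)
    then obtain w where w: "w ^ (n + 1) = 1" "cmod (v - w) \<le> 3 * cmod x"
      using near_unity_root[of "n + 1" v x] x gNB by auto
    have nw: "cmod w = 1" by (rule unity_root_norm[OF w(1)]) simp
    have lip: "cmod (perturbation n v - perturbation n w) \<le> L * cmod (v - w)"
      unfolding L_def by (rule perturbation_lipschitz) (use n v2 nw in auto)
    show ?thesis
    proof (cases "w = 1")
      case True
      have "perturbation n w = 0" using True by (simp add: perturbation_def)
      hence "cmod (perturbation n v) \<le> L * cmod (v - 1)" using lip True by simp
      hence "cmod x \<le> g * ?N * (L * cmod (v - 1))" unfolding nx using g by (intro mult_left_mono) auto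
      also have "\<dots> = (g * ?N * L) * cmod (v - 1)" by simp
      also have "\<dots> \<le> (1 / 8) * cmod (v - 1)"
      proof (rule mult_right_mono)
        have "g * ?N * L \<le> g * ?N * B" using g BL by (intro mult_left_mono) auto
        thus "g * ?N * L \<le> 1 / 8" using gNB by (simp only: mult.assoc)
      qed simp
      finally have "8 * cmod x \<le> cmod (v - 1)" by simp
      moreover have "cmod (v - 1) \<le> 3 * cmod x" using w(2) True by simp
      ultimately have "cmod (v - 1) \<le> 0" using norm_ge_zero[of "v - 1"] by linarith
      thus ?thesis by simp
    next
      case False
      have near: "cmod (v - w) \<le> 3 * ?N * B * g" using w(2) x by (simp add: algebra_simps)
      define y where "y = of_real (g * ?N) * (perturbation n v - perturbation n w)"
      have "cmod y = g * ?N * cmod (perturbation n v - perturbation n w)"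
        using g by (simp add: y_def norm_mult del: of_nat_Suc of_nat_add)
      also have "\<dots> \<le> g * ?N * (L * (3 * ?N * B * g))"
        using g BL near by (intro mult_left_mono order_trans[OF lip]) auto
      finally have y: "cmod y \<le> C' * g\<^sup>2" by (simp add: C'_def power2_eq_square mult_ac)
      have "x = of_real (g * ?N) * perturbation n w + y" by (simp add: x_def y_def algebra_simps)
      hence "Re x = g * ?N * Re (perturbation n w) + Re y" by (simp del: of_nat_Suc of_nat_add)
      hence Rx: "Re x \<le> g * ?N * Re (perturbation n w) + C' * g\<^sup>2"
        using y complex_Re_le_cmod[of y] by linarith
      have "(cmod x)\<^sup>2 \<le> (g * (?N * B))\<^sup>2" using x by (intro power_mono) auto
      hence x2: "(cmod x)\<^sup>2 \<le> (?N * B)\<^sup>2 * g\<^sup>2" by (simp only: power_mult_distrib mult_ac)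
      have rearr: "2 * (g * ?N * p) = ?N * (2 * g * p)" for p by simp
      have "1 + ?N * ((cmod v)\<^sup>2 - 1) \<le> (1 + ((cmod v)\<^sup>2 - 1)) ^ (n + 1)"
        by (rule Bernoulli_inequality) simp
      also have "\<dots> = ((cmod v)\<^sup>2) ^ (n + 1)" by simp
      also have "\<dots> = (cmod (v ^ (n + 1)))\<^sup>2"
        by (simp only: norm_power power_mult[symmetric] mult.commute)
      also have "\<dots> = (cmod (1 + x))\<^sup>2" unfolding v x_def ..
      also have "\<dots> = 1 + 2 * Re x + (cmod x)\<^sup>2" unfolding cmod_power2 by (simp add: power2_eq_square algebra_simps)
      also have "\<dots> \<le> 1 + 2 * (g * ?N * Re (perturbation n w)) + (2 * C' + (?N * B)\<^sup>2) * g\<^sup>2"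
        using Rx x2 unfolding distrib_right by linarith
      finally have "?N * ((cmod v)\<^sup>2 - 1) \<le> ?N * (2 * g * Re (perturbation n w)) + (2 * C' + (?N * B)\<^sup>2) * g\<^sup>2"
        unfolding rearr by (simp only: add.assoc add_le_cancel_left)
      also have "(2 * C' + (?N * B)\<^sup>2) * g\<^sup>2 \<le> ?N * ((2 * C' + (?N * B)\<^sup>2) * g\<^sup>2)"
        using mult_right_mono[OF BL(4), of "(2 * C' + (?N * B)\<^sup>2) * g\<^sup>2"] C' by simp
      finally have "?N * ((cmod v)\<^sup>2 - 1) \<le> ?N * (2 * g * Re (perturbation n w) + (2 * C' + (?N * B)\<^sup>2) * g\<^sup>2)"
        by (simp only: distrib_left)
      hence "(cmod v)\<^sup>2 - 1 \<le> 2 * g * Re (perturbation n w) + (2 * C' + (?N * B)\<^sup>2) * g\<^sup>2"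
        by (rule mult_left_le_imp_le) simp
      also have "(2 * C' + (?N * B)\<^sup>2) * g\<^sup>2 \<le> C * g\<^sup>2"
        unfolding C_def using BL by (intro mult_right_mono) auto
      finally have "(cmod v)\<^sup>2 \<le> 1 + 2 * g * Re (perturbation n w) + C * g\<^sup>2" by simp
      moreover have "cmod (v - w) \<le> C * g"
      proof -
        have "3 * ?N * B * g \<le> C * g" unfolding C_def using g C' by (intro mult_right_mono) auto
        with near show ?thesis by linarith
      qed
      moreover have "w \<in> nontrivial_unity_roots (n + 1)" using w False by (simp add: nontrivial_unity_roots_def)
      ultimately show ?thesis by blast
    qed
  qed
  show ?thesis by (rule that[OF C g\<^sub>0(1,2)]) (rule main; assumption)
qed

definition deformed_poly :: "nat \<Rightarrow> real \<Rightarrow> complex poly" where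
  "deformed_poly n g = monom 1 (n + 1) - 1 - smult (of_real (g * real (n + 1)))
     (smult (1 / of_nat n) (monom 1 n - 1) - smult (1 / of_nat (n - 1)) (monom 1 (n - 1) - 1))"

lemma poly_deformed_poly:
  "poly (deformed_poly n g) v = v ^ (n + 1) - 1 - of_real (g * real (n + 1)) * perturbation n v"
  by (simp add: deformed_poly_def perturbation_def poly_monom diff_divide_distrib
      del: of_nat_Suc of_nat_add)

lemma degree_deformed_poly: "degree (deformed_poly n g) = n + 1"
proof -
  define q :: "complex poly" where "q = 1 + smult (of_real (g * real (n + 1)))
     (smult (1 / of_nat n) (monom 1 n - 1) - smult (1 / of_nat (n - 1)) (monom 1 (n - 1) - 1))"
  have "degree q \<le> n" unfolding q_def
    by (intro degree_add_le degree_diff_le order_trans[OF degree_smult_le] order_trans[OF degree_monom_le]) auto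
  hence "degree (monom (1::complex) (n + 1) + - q) = degree (monom (1::complex) (n + 1))"
    by (intro degree_add_eq_left) (simp add: degree_monom_eq)
  moreover have "deformed_poly n g = monom 1 (n + 1) + - q" by (simp add: deformed_poly_def q_def)
  ultimately show ?thesis by (simp add: degree_monom_eq)
qed

lemma poly_pderiv_deformed_poly:
  assumes "n \<ge> 2"
  shows "poly (pderiv (deformed_poly n g)) v =
    of_nat (n + 1) * v ^ (n - 2) * (v\<^sup>2 - of_real g * v + of_real g)"
proof -
  obtain m where m: "n = Suc (Suc m)" using assms by (metis Suc_le_D numeral_2_eq_2 Suc_le_mono)
  have 1: "of_nat n * (1 / of_nat n :: complex) = 1" "of_nat (n - 1) * (1 / of_nat (n - 1) :: complex) = 1"
    using assms by auto
  have "poly (pderiv (deformed_poly n g)) v = of_nat (n + 1) * v ^ n - of_real (g * real (n + 1)) *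
     ((of_nat n * (1 / of_nat n)) * v ^ (n - 1) - (of_nat (n - 1) * (1 / of_nat (n - 1))) * v ^ (n - 2))"
    by (simp add: deformed_poly_def pderiv_diff pderiv_smult pderiv_monom poly_monom pderiv_1
        numeral_2_eq_2 del: of_nat_Suc of_nat_add)
  also have "\<dots> = of_nat (n + 1) * v ^ (n - 2) * (v\<^sup>2 - of_real g * v + of_real g)"
    unfolding 1 by (simp add: m power2_eq_square algebra_simps)
  finally show ?thesis .
qed

text \<open>
  For \<open>0 \<le> g < 4\<close> the roots are complex conjugate, and the product of their distances to \<open>1\<close> is the
  value \<open>1 - g + g = 1\<close> of the quadratic at \<open>1\<close>.
\<close>
lemma quadratic_root_dist_one:
  assumes "0 \<le> g" "g < 4" "v\<^sup>2 - of_real g * v + of_real g = (0::complex)"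
  shows "cmod (v - 1) = 1"
proof -
  define x y where "x = Re v" and "y = Im v"
  have re: "x\<^sup>2 - y\<^sup>2 - g * x + g = 0" and im: "y * (2 * x - g) = 0"
    using assms(3) by (auto simp: complex_eq_iff x_def y_def power2_eq_square algebra_simps)
  have "(x - 1)\<^sup>2 + y\<^sup>2 = 1"
  proof (cases "y = 0")
    case True
    have "4 * (x\<^sup>2 - g * x + g) = (2 * x - g)\<^sup>2 + g * (4 - g)"
      by (simp add: power2_eq_square algebra_simps)
    moreover have "0 \<le> g * (4 - g)" using assms by simp
    moreover have "4 * (x\<^sup>2 - g * x + g) = 0" using re True by simp
    ultimately have "(2 * x - g)\<^sup>2 = 0" "g * (4 - g) = 0"
      using zero_le_power2[of "2 * x - g"] by linarith+
    hence "g = 0" "x = 0" using assms by auto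
    thus ?thesis using True by simp
  next
    case False
    hence "g = 2 * x" using im by simp
    thus ?thesis using re by (simp add: power2_eq_square algebra_simps)
  qed
  hence "(cmod (v - 1))\<^sup>2 = 1" by (simp add: cmod_power2 x_def y_def)
  thus ?thesis by (metis norm_ge_zero power2_eq_1_iff neg_0_le_iff_le not_one_le_zero)
qed

lemma Re_perturbation_unity_root:
  assumes n: "n \<ge> 2" and w: "w \<in> nontrivial_unity_roots (n + 1)"
  shows "Re (perturbation n w) = (1 - Re w) * (2 * (1 + Re w) / (real n - 1) - 1 / real n)"
proof -
  have wN: "w ^ (n + 1) = 1" and nw: "cmod w = 1" using nontrivial_unity_rootsD[OF w] by auto
  have 1: "w ^ n = cnj w" using cnj_unity_root_power[OF wN, of 1] by simp
  have 2: "w ^ (n - 1) = cnj w ^ 2" using cnj_unity_root_power[OF wN, of 2] n by simp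
  have "(Re w)\<^sup>2 + (Im w)\<^sup>2 = 1" using nw cmod_power2[of w] by simp
  hence 3: "Re (cnj w ^ 2) = 2 * (Re w)\<^sup>2 - 1" by (simp add: power2_eq_square)
  have "Re (perturbation n w) = (Re w - 1) / real n - (2 * (Re w)\<^sup>2 - 1 - 1) / real (n - 1)"
    unfolding perturbation_def 1 2 minus_complex.sel Re_divide_of_nat 3 by simp
  also have "real (n - 1) = real n - 1" using n by simp
  finally show ?thesis by (simp add: divide_inverse power2_eq_square algebra_simps)
qed

section \<open>The lower bound\<close>

text \<open>
  In the coordinate \<open>v = 1 + (z - \<beta>) / r\<close> the unit disk condition for a root near \<open>w\<close> reads
  \<open>|r v + (\<beta> - r)| \<le> 1\<close>. Expanded to first order it is the constraint of \<open>w\<close>, which holds for the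
  optimal \<open>t\<close> and \<open>r = 1 - K \<epsilon>\<close>. Decreasing \<open>r\<close> by \<open>C \<epsilon>\<^sup>2\<close> creates a slack of order \<open>C \<epsilon>\<^sup>2\<close>. The
  second-order error is bounded by \<open>C4 \<epsilon>\<^sup>2\<close> with \<open>C4\<close> independent of \<open>C\<close> as long as \<open>C \<epsilon> \<le> 1\<close>, so a
  large \<open>C\<close> absorbs it.
\<close>
lemma crit_dist_lower_bound:
  assumes n: "n \<ge> 3"
  obtains C \<beta>\<^sub>0 :: real where "0 \<le> C" "0 \<le> \<beta>\<^sub>0" "\<beta>\<^sub>0 < 1"
    "\<And>\<beta>. \<lbrakk>\<beta>\<^sub>0 < \<beta>; \<beta> < 1\<rbrakk> \<Longrightarrow> \<exists>P\<in>S_polys (n + 1) \<beta>.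
       1 - sendov_slope n * (1 - \<beta>) - C * (1 - \<beta>)\<^sup>2 \<le> crit_dist \<beta> P"
proof -
  define K where "K = sendov_slope n"
  have K: "0 < K" "K < 1" using sendov_slope_pos[of n] sendov_slope_less_1[of n] n by (auto simp: K_def)
  obtain t where t: "t \<ge> 0" "K = 1 + max_constraint n t"
    using sendov_slope_attained[of n] n unfolding K_def by auto
  obtain A g\<^sub>0 where A: "A \<ge> 0" and g\<^sub>0: "0 < g\<^sub>0" "g\<^sub>0 \<le> 1" and
    roots: "\<And>g v. \<lbrakk>0 \<le> g; g \<le> g\<^sub>0; v ^ (n + 1) = 1 + of_real (g * real (n + 1)) * perturbation n v\<rbrakk> \<Longrightarrow>
       v = 1 \<or> (\<exists>w\<in>nontrivial_unity_roots (n + 1). cmod (v - w) \<le> A * g \<and>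
         (cmod v)\<^sup>2 \<le> 1 + 2 * g * Re (perturbation n w) + A * g\<^sup>2)"
    using perturbed_unity_roots[OF n] by blast
  obtain m where m: "m > 0" "\<And>w. w \<in> nontrivial_unity_roots (n + 1) \<Longrightarrow> m \<le> 1 - Re w"
    using nontrivial_unity_roots_gap[of n] n by auto
  define C4 where "C4 = 4 + 32 * t + A * t\<^sup>2 + 4 * (1 + A * t) + 2 * A * t + 1"
  define C where "C = C4 / m"
  have C4: "C4 \<ge> 0" unfolding C4_def using t A by simp
  have C: "C \<ge> 0" using C4 m by (simp add: C_def)
  define e where "e = min (1 / 4) (min (1 / (C + 1)) (g\<^sub>0 / (t + 1)))"
  have e: "0 < e" "e \<le> 1 / 4" "e \<le> 1 / (C + 1)" "e \<le> g\<^sub>0 / (t + 1)"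
  proof -
    show "0 < e" unfolding e_def min_less_iff_conj using C t g\<^sub>0 by simp
  qed (unfold e_def, (meson min.cobounded1 min.cobounded2 order_trans)+)
  have main: "\<exists>P\<in>S_polys (n + 1) \<beta>. 1 - K * (1 - \<beta>) - C * (1 - \<beta>)\<^sup>2 \<le> crit_dist \<beta> P"
    if \<beta>: "1 - e < \<beta>" "\<beta> < 1" for \<beta>
  proof -
    define \<epsilon> where "\<epsilon> = 1 - \<beta>"
    have \<epsilon>: "0 < \<epsilon>" "\<epsilon> < e" "\<epsilon> \<le> 1 / 4" using \<beta> e by (auto simp: \<epsilon>_def)
    define g where "g = t * \<epsilon>"
    have g: "0 \<le> g" "g \<le> g\<^sub>0"
    proof -
      have "\<epsilon> * (t + 1) \<le> g\<^sub>0 / (t + 1) * (t + 1)" using \<epsilon> e t by (intro mult_right_mono) auto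
      also have "\<dots> = g\<^sub>0" using t by simp
      finally show "g \<le> g\<^sub>0" using \<epsilon> by (simp add: g_def algebra_simps)
    qed (use t \<epsilon> in \<open>auto simp: g_def\<close>)
    have C\<epsilon>: "0 \<le> C * \<epsilon>" "C * \<epsilon> \<le> 1"
    proof -
      have "(C + 1) * \<epsilon> \<le> (C + 1) * (1 / (C + 1))" using \<epsilon> e C by (intro mult_left_mono) auto
      also have "\<dots> = 1" using C by simp
      finally show "C * \<epsilon> \<le> 1" using \<epsilon> by (simp add: algebra_simps)
    qed (use C \<epsilon> in auto)
    \<comment> \<open>\<open>a \<epsilon> = \<beta> - r\<close> is the shift between the coordinates \<open>z\<close> and \<open>r v\<close>.\<close>
    define a where "a = K - 1 + C * \<epsilon>"
    define r where "r = 1 - (1 + a) * \<epsilon>"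
    have a: "-1 < a" "a < 1" using K C\<epsilon> by (auto simp: a_def)
    have a\<epsilon>: "0 \<le> (1 + a) * \<epsilon>" "(1 + a) * \<epsilon> \<le> 2 * \<epsilon>" using a \<epsilon> by (auto intro!: mult_right_mono)
    hence r: "1 / 2 \<le> r" "r \<le> 1" "1 - r \<le> 2 * \<epsilon>" using \<epsilon> unfolding r_def by linarith+
    have r2: "0 \<le> 1 - r\<^sup>2" "1 - r\<^sup>2 \<le> 4 * \<epsilon>" "r\<^sup>2 \<le> 1 - 2 * ((1 + a) * \<epsilon>) + 4 * \<epsilon>\<^sup>2"
    proof -
      show "0 \<le> 1 - r\<^sup>2" using r by (simp add: power_le_one)
      have "1 - r\<^sup>2 = (1 - r) * (1 + r)" by (simp add: power2_eq_square algebra_simps)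
      also have "\<dots> \<le> (2 * \<epsilon>) * 2" using r \<epsilon> by (intro mult_mono) auto
      finally show "1 - r\<^sup>2 \<le> 4 * \<epsilon>" by simp
      have "((1 + a) * \<epsilon>)\<^sup>2 \<le> (2 * \<epsilon>)\<^sup>2" using a\<epsilon> by (intro power_mono) auto
      moreover have "r\<^sup>2 = 1 - 2 * ((1 + a) * \<epsilon>) + ((1 + a) * \<epsilon>)\<^sup>2"
        unfolding r_def by (simp add: power2_diff)
      ultimately show "r\<^sup>2 \<le> 1 - 2 * ((1 + a) * \<epsilon>) + 4 * \<epsilon>\<^sup>2" by (simp add: power_mult_distrib)
    qed
    define f where "f = deformed_poly n g"
    define l :: "complex poly" where "l = [:of_real (1 - \<beta> / r), of_real (1 / r):]"
    define P where "P = pcompose f l"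
    have r0: "r \<noteq> 0" "r > 0" using r by auto
    have lz: "poly l (of_real \<beta> + of_real r * (v - 1)) = v" for v
      using r0 by (simp add: l_def field_simps)
    have lz': "z = of_real \<beta> + of_real r * (poly l z - 1)" for z
      using r0 by (simp add: l_def field_simps)
    have in_disk: "cmod (of_real \<beta> + of_real r * (v - 1)) \<le> 1" if "poly f v = 0" for v
    proof -
      have "v ^ (n + 1) = 1 + of_real (g * real (n + 1)) * perturbation n v"
        using that unfolding f_def poly_deformed_poly by (simp add: algebra_simps del: of_nat_Suc of_nat_add)
      from roots[OF g this] consider "v = 1" | w where "w \<in> nontrivial_unity_roots (n + 1)"
        "cmod (v - w) \<le> A * g" "(cmod v)\<^sup>2 \<le> 1 + 2 * g * Re (perturbation n w) + A * g\<^sup>2" by blast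
      thus ?thesis
      proof cases
        case 1
        thus ?thesis using \<beta> e by simp
      next
        case 2
        define u where "u = Re w"
        define q where "q = Re (perturbation n w)"
        have w1: "Re w < 1" "- 1 \<le> Re w" "cmod w = 1" using nontrivial_unity_rootsD[OF 2(1)] by auto
        have u: "m \<le> 1 - u" "1 - u \<le> 2" "\<bar>u\<bar> \<le> 1" using m(2)[OF 2(1)] w1 by (auto simp: u_def)
        have q4: "\<bar>q\<bar> \<le> 4"
          using abs_Re_le_cmod[of "perturbation n w"] norm_perturbation_le[of n 1 w] w1 n
          by (simp add: q_def)
        have g\<epsilon>: "A * g = A * t * \<epsilon>" "A * t * \<epsilon> \<le> A * t" using A t \<epsilon> by (auto simp: g_def mult_left_le)
        define R where "R = Re v"
        have Ru: "\<bar>R - u\<bar> \<le> A * t * \<epsilon>"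
          using 2(2) abs_Re_le_cmod[of "v - w"] g\<epsilon> by (simp add: R_def u_def)
        have R1: "\<bar>R\<bar> \<le> 1 + A * t" using Ru u(3) g\<epsilon>(2) by linarith
        have z: "of_real \<beta> + of_real r * (v - 1) = of_real r * v + of_real (a * \<epsilon>)"
          by (simp add: r_def \<epsilon>_def algebra_simps)
        have "(cmod (of_real r * v + of_real (a * \<epsilon>)))\<^sup>2 = r\<^sup>2 * (cmod v)\<^sup>2 + 2 * (r * (a * \<epsilon>) * R) + (a * \<epsilon>)\<^sup>2"
          unfolding cmod_power2 by (simp add: R_def power2_eq_square algebra_simps)
        moreover have "r\<^sup>2 * (cmod v)\<^sup>2 \<le> 1 - 2 * ((1 + a) * \<epsilon>) + 2 * g * q + (4 + 32 * t + A * t\<^sup>2) * \<epsilon>\<^sup>2"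
        proof -
          have "r\<^sup>2 * (cmod v)\<^sup>2 \<le> r\<^sup>2 * (1 + 2 * g * q + A * g\<^sup>2)"
            using 2(3) by (intro mult_left_mono) (auto simp: q_def)
          also have "\<dots> = r\<^sup>2 + 2 * g * q + (1 - r\<^sup>2) * (2 * g * - q) + r\<^sup>2 * (A * g\<^sup>2)"
            by (simp add: algebra_simps)
          also have "(1 - r\<^sup>2) * (2 * g * - q) \<le> (4 * \<epsilon>) * (2 * g * 4)"
          proof -
            have "(1 - r\<^sup>2) * (2 * g * - q) \<le> (1 - r\<^sup>2) * (2 * g * 4)"
              using r2 g q4 by (intro mult_left_mono) auto
            also have "\<dots> \<le> (4 * \<epsilon>) * (2 * g * 4)" using r2 g by (intro mult_right_mono) auto
            finally show ?thesis .
          qed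
          also have "(4 * \<epsilon>) * (2 * g * 4) = 32 * t * \<epsilon>\<^sup>2" by (simp add: g_def power2_eq_square)
          also have "r\<^sup>2 * (A * g\<^sup>2) \<le> 1 * (A * g\<^sup>2)" using r2 A by (intro mult_right_mono) auto
          also have "1 * (A * g\<^sup>2) = A * t\<^sup>2 * \<epsilon>\<^sup>2" by (simp add: g_def power_mult_distrib)
          finally show ?thesis using r2(3) unfolding distrib_right by linarith
        qed
        moreover have "2 * (r * (a * \<epsilon>) * R) \<le> 2 * (a * \<epsilon> * u) + (4 * (1 + A * t) + 2 * A * t) * \<epsilon>\<^sup>2"
        proof -
          have "r * R - u = (R - u) - (1 - r) * R" by (simp add: algebra_simps)
          also have "\<bar>\<dots>\<bar> \<le> \<bar>R - u\<bar> + (1 - r) * \<bar>R\<bar>"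
            using r by (intro order_trans[OF abs_triangle_ineq4]) (simp add: abs_mult)
          also have "\<dots> \<le> A * t * \<epsilon> + (2 * \<epsilon>) * (1 + A * t)"
            using Ru R1 r \<epsilon> by (intro add_mono mult_mono) auto
          finally have D: "\<bar>r * R - u\<bar> \<le> (2 * (1 + A * t) + A * t) * \<epsilon>" by (simp add: algebra_simps)
          have "a * \<epsilon> * (r * R - u) \<le> \<bar>a * \<epsilon>\<bar> * \<bar>r * R - u\<bar>" by (metis abs_ge_self abs_mult)
          also have "\<dots> \<le> \<epsilon> * ((2 * (1 + A * t) + A * t) * \<epsilon>)"
          proof (rule mult_mono[OF _ D])
            show "\<bar>a * \<epsilon>\<bar> \<le> \<epsilon>" using a \<epsilon> by (simp add: abs_mult mult_left_le_one_le)
          qed (use \<epsilon> in auto)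
          finally have "a * \<epsilon> * (r * R - u) \<le> (2 * (1 + A * t) + A * t) * \<epsilon>\<^sup>2"
            by (simp add: power2_eq_square mult_ac)
          thus ?thesis by (simp add: algebra_simps)
        qed
        moreover have "(a * \<epsilon>)\<^sup>2 \<le> 1 * \<epsilon>\<^sup>2"
          unfolding power_mult_distrib using a by (intro mult_right_mono) (auto simp: abs_square_le_1)
        ultimately have "(cmod (of_real r * v + of_real (a * \<epsilon>)))\<^sup>2 \<le>
            1 - 2 * ((1 + a) * \<epsilon>) + 2 * g * q + 2 * (a * \<epsilon> * u) + C4 * \<epsilon>\<^sup>2"
          unfolding C4_def distrib_right by linarith
        also have "\<dots> = 1 + 2 * \<epsilon> * (t * q - 1 - a * (1 - u)) + C4 * \<epsilon>\<^sup>2"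
          by (simp add: g_def algebra_simps)
        also have "t * q - 1 - a * (1 - u) \<le> - (m * (C * \<epsilon>))"
        proof -
          have q: "q = (1 - u) * (2 * (1 + u) / (real n - 1) - 1 / real n)"
            unfolding q_def u_def by (rule Re_perturbation_unity_root) (use n 2 in auto)
          have "(1 - u) * (1 / (1 - u)) = 1" using u m by simp
          hence "t * q - 1 - a * (1 - u) = (1 - u) * (root_constraint n t u - a)"
            unfolding q root_constraint_def by (simp only: right_diff_distrib mult.left_commute mult.commute)
          also have "\<dots> \<le> (1 - u) * (- (C * \<epsilon>))"
          proof (rule mult_left_mono)
            have "root_constraint n t u \<le> max_constraint n t"
              unfolding u_def by (rule root_constraint_le_max[OF 2(1)])
            thus "root_constraint n t u - a \<le> - (C * \<epsilon>)" using t(2) by (simp add: a_def)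
          qed (use u m in simp)
          also have "\<dots> \<le> - (m * (C * \<epsilon>))" using mult_right_mono[OF u(1) C\<epsilon>(1)] by simp
          finally show ?thesis .
        qed
        hence "2 * \<epsilon> * (t * q - 1 - a * (1 - u)) \<le> 2 * \<epsilon> * (- (m * (C * \<epsilon>)))"
          by (rule mult_left_mono) (use \<epsilon> in simp)
        hence "1 + 2 * \<epsilon> * (t * q - 1 - a * (1 - u)) + C4 * \<epsilon>\<^sup>2 \<le>
            1 + 2 * \<epsilon> * (- (m * (C * \<epsilon>))) + C4 * \<epsilon>\<^sup>2" by linarith
        also have "\<dots> = 1 - C4 * \<epsilon>\<^sup>2" using m by (simp add: C_def power2_eq_square algebra_simps)
        also have "\<dots> \<le> 1" using C4 by simp
        finally have "(cmod (of_real r * v + of_real (a * \<epsilon>)))\<^sup>2 \<le> 1" .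
        thus ?thesis unfolding z by (simp add: abs_square_le_1)
      qed
    qed
    have P: "P \<in> S_polys (n + 1) \<beta>"
    proof -
      have "degree P = n + 1"
        using r0 by (simp add: P_def degree_pcompose f_def degree_deformed_poly l_def)
      moreover have "cmod z \<le> 1" if "poly P z = 0" for z
        using in_disk[of "poly l z"] that lz'[of z] by (simp add: P_def poly_pcompose)
      moreover have "poly P (of_real \<beta>) = 0"
        using lz[of 1] by (simp add: P_def poly_pcompose f_def poly_deformed_poly perturbation_def)
      ultimately show ?thesis by (auto simp: S_polys_def)
    qed
    have crit: "poly (pderiv P) z = 0 \<longleftrightarrow> poly (pderiv f) (poly l z) = 0" for z
    proof -
      have "pderiv l = [:of_real (1 / r):]" by (simp add: l_def pderiv_pCons)
      thus ?thesis using r0 by (simp add: P_def pderiv_pcompose poly_pcompose)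
    qed
    have "r \<le> crit_dist \<beta> P"
    proof -
      have "poly (pderiv f) 0 = 0" using n by (simp add: f_def poly_pderiv_deformed_poly)
      hence "poly (pderiv P) (of_real \<beta> + of_real r * (0 - 1)) = 0" unfolding crit lz .
      hence ne: "{z. poly (pderiv P) z = 0} \<noteq> {}" by blast
      have "r \<le> dist (of_real \<beta>) z" if "poly (pderiv P) z = 0" for z
      proof -
        define v where "v = poly l z"
        have "poly (pderiv f) v = 0" using that crit by (simp add: v_def)
        hence "v ^ (n - 2) = 0 \<or> v\<^sup>2 - of_real g * v + of_real g = 0"
          using n unfolding f_def by (subst (asm) poly_pderiv_deformed_poly) (auto simp del: of_nat_Suc of_nat_add)
        moreover have "g < 4" using g g\<^sub>0 by simp
        ultimately have "cmod (v - 1) = 1" using quadratic_root_dist_one[OF g(1)] by auto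
        moreover have "dist (of_real \<beta>) z = r * cmod (v - 1)"
          using r0 by (subst lz'[of z]) (simp add: dist_norm norm_mult v_def)
        ultimately show ?thesis by simp
      qed
      thus ?thesis unfolding crit_dist_def infdist_notempty[OF ne] by (intro cINF_greatest[OF ne]) auto
    qed
    moreover have "r = 1 - K * (1 - \<beta>) - C * (1 - \<beta>)\<^sup>2"
      by (simp add: r_def a_def \<epsilon>_def power2_eq_square algebra_simps)
    ultimately show ?thesis using P by auto
  qed
  show ?thesis
    by (rule that[of C "1 - e"]) (use C e main in \<open>auto simp: K_def\<close>)
qed

section \<open>The expansion of the Sendov radius\<close>

theorem corollary3:
  shows "\<exists>K :: nat \<Rightarrow> real.
    (\<forall>n\<ge>3. K n > 0) \<and>
    K \<longlonglongrightarrow> 1 / 3 \<and>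
    (\<forall>n\<ge>3. \<exists>C \<beta>\<^sub>0 :: real. 0 \<le> \<beta>\<^sub>0 \<and> \<beta>\<^sub>0 < 1 \<and>
       (\<forall>\<beta>. \<beta>\<^sub>0 < \<beta> \<and> \<beta> < 1 \<longrightarrow>
          \<bar>r_sup (n + 1) \<beta> - (1 - K n * (1 - \<beta>))\<bar> \<le> C * (1 - \<beta>)\<^sup>2))"
proof (intro exI[of _ sendov_slope] conjI allI impI)
  fix n :: nat assume n: "3 \<le> n"
  show "0 < sendov_slope n" using n by (intro sendov_slope_pos) simp
  obtain C1 b1 where 1: "0 \<le> C1" "0 \<le> b1" "b1 < 1"
    "\<And>\<beta> P. \<lbrakk>b1 < \<beta>; \<beta> < 1; P \<in> S_polys (n + 1) \<beta>\<rbrakk> \<Longrightarrow>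
       crit_dist \<beta> P \<le> 1 - sendov_slope n * (1 - \<beta>) + C1 * (1 - \<beta>)\<^sup>2"
    using crit_dist_upper_bound[OF n] by blast
  obtain C2 b2 where 2: "0 \<le> C2" "0 \<le> b2" "b2 < 1"
    "\<And>\<beta>. \<lbrakk>b2 < \<beta>; \<beta> < 1\<rbrakk> \<Longrightarrow> \<exists>P\<in>S_polys (n + 1) \<beta>.
       1 - sendov_slope n * (1 - \<beta>) - C2 * (1 - \<beta>)\<^sup>2 \<le> crit_dist \<beta> P"
    using crit_dist_lower_bound[OF n] by blast
  have main: "\<bar>r_sup (n + 1) \<beta> - (1 - sendov_slope n * (1 - \<beta>))\<bar> \<le> (C1 + C2) * (1 - \<beta>)\<^sup>2"
    if \<beta>: "max b1 b2 < \<beta>" "\<beta> < 1" for \<beta>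
  proof -
    obtain P where P: "P \<in> S_polys (n + 1) \<beta>"
      "1 - sendov_slope n * (1 - \<beta>) - C2 * (1 - \<beta>)\<^sup>2 \<le> crit_dist \<beta> P"
      using 2(4)[of \<beta>] \<beta> by auto
    have up: "crit_dist \<beta> Q \<le> 1 - sendov_slope n * (1 - \<beta>) + C1 * (1 - \<beta>)\<^sup>2"
      if "Q \<in> S_polys (n + 1) \<beta>" for Q using 1(4) \<beta> that by auto
    have "r_sup (n + 1) \<beta> \<le> 1 - sendov_slope n * (1 - \<beta>) + C1 * (1 - \<beta>)\<^sup>2"
      unfolding r_sup_def by (rule cSUP_least) (use P up in auto)
    moreover have "crit_dist \<beta> P \<le> r_sup (n + 1) \<beta>"
      unfolding r_sup_def by (rule cSUP_upper[OF P(1)]) (rule bdd_aboveI2, rule up)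
    moreover have "0 \<le> C1 * (1 - \<beta>)\<^sup>2" "0 \<le> C2 * (1 - \<beta>)\<^sup>2" using 1 2 by auto
    ultimately show ?thesis using P(2) unfolding distrib_right by linarith
  qed
  show "\<exists>C \<beta>\<^sub>0 :: real. 0 \<le> \<beta>\<^sub>0 \<and> \<beta>\<^sub>0 < 1 \<and>
       (\<forall>\<beta>. \<beta>\<^sub>0 < \<beta> \<and> \<beta> < 1 \<longrightarrow>
          \<bar>r_sup (n + 1) \<beta> - (1 - sendov_slope n * (1 - \<beta>))\<bar> \<le> C * (1 - \<beta>)\<^sup>2)"
    by (rule exI[of _ "C1 + C2"], rule exI[of _ "max b1 b2"]) (use 1 2 main in auto)
qed (rule sendov_slope_tendsto)

end
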